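(* Let $(M^n,g)$ be any Hermitian manifold with $n\geq 3$. Then within the conformal class of $g$ (the metrics $e^{2u}g$ with $u$ a smooth real function on $M$) there is at most one Strominger Kähler-like (SKL) metric, up to constant multiples.
   Context: Manifolds are connected; $n$ is the complex dimension; $M$ need not be compact. For a Hermitian manifold $(M^n,g)$ with complex structure $J$, the Strominger (Bismut) connection $\nabla^s$ is the unique connection with $\nabla^s g=0$, $\nabla^s J=0$ whose torsion $T^s$ is totally skew-symmetric (i.e. $g(T^s(x,y),z)$ is a $3$-form). The metric $g$ is Strominger Kähler-like (SKL) if the curvature tensor $R^s$ of $\nabla^s$ has all the symmetries of the curvature of a Kähler manifold: $R^s(x,y,z,w)+R^s(y,z,x,w)+R^s(z,x,y,w)=0$ and $R^s(x,y,z,w)=R^s(Jx,Jy,z,w)=R^s(x,y,Jz,Jw)$ for all real tangent vectors $x,y,z,w$. *)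

theory Defs
  imports "HOL-Analysis.Analysis"
begin

section \<open>Smooth and holomorphic maps on open sets\<close>

text \<open>For open \<open>S\<close> in a finite-dimensional space this is the usual class of \<open>k\<close> times
  continuously differentiable maps.\<close>

primrec Ck_on :: "nat \<Rightarrow> 'v::real_normed_vector set \<Rightarrow> ('v \<Rightarrow> 'w::real_normed_vector) \<Rightarrow> bool" where
  "Ck_on 0 S f \<longleftrightarrow> continuous_on S f"
| "Ck_on (Suc k) S f \<longleftrightarrow> (\<forall>x\<in>S. f differentiable (at x)) \<and>
     (\<forall>v. Ck_on k S (\<lambda>x. frechet_derivative f (at x) v))"

definition smooth_map_on :: "'v::real_normed_vector set \<Rightarrow> ('v \<Rightarrow> 'w::real_normed_vector) \<Rightarrow> bool" where
  "smooth_map_on S f \<longleftrightarrow> (\<forall>k. Ck_on k S f)"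

definition holomorphic_map_on :: "(complex^'n) set \<Rightarrow> (complex^'n \<Rightarrow> complex^'m) \<Rightarrow> bool" where
  "holomorphic_map_on S f \<longleftrightarrow>
     (\<forall>x\<in>S. \<exists>f'. (f has_derivative f') (at x) \<and> (\<forall>c v. f' (c *s v) = c *s f' v))"


section \<open>Complex manifolds\<close>

type_synonym ('a, 'n) chart = "'a set \<times> ('a \<Rightarrow> complex^'n)"

abbreviation chart_image :: "('a, 'n::finite) chart \<Rightarrow> (complex^'n) set" where
  "chart_image \<phi> \<equiv> snd \<phi> ` fst \<phi>"

definition chart_inv :: "('a, 'n::finite) chart \<Rightarrow> complex^'n \<Rightarrow> 'a" where
  "chart_inv \<phi> = inv_into (fst \<phi>) (snd \<phi>)"

definition is_chart :: "'a topology \<Rightarrow> ('a, 'n::finite) chart \<Rightarrow> bool" where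
  "is_chart X \<phi> \<longleftrightarrow> openin X (fst \<phi>) \<and> open (chart_image \<phi>) \<and>
     homeomorphic_map (subtopology X (fst \<phi>)) (top_of_set (chart_image \<phi>)) (snd \<phi>)"

definition overlap :: "('a, 'n::finite) chart \<Rightarrow> ('a, 'n) chart \<Rightarrow> (complex^'n) set" where
  "overlap \<phi> \<psi> = snd \<phi> ` (fst \<phi> \<inter> fst \<psi>)"

definition transition :: "('a, 'n::finite) chart \<Rightarrow> ('a, 'n) chart \<Rightarrow> complex^'n \<Rightarrow> complex^'n" where
  "transition \<phi> \<psi> = snd \<psi> \<circ> chart_inv \<phi>"

definition complex_manifold :: "'a topology \<Rightarrow> ('a, 'n::finite) chart set \<Rightarrow> bool" where
  "complex_manifold X A \<longleftrightarrow>
     Hausdorff_space X \<and> second_countable X \<and>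
     (\<forall>\<phi>\<in>A. is_chart X \<phi>) \<and> (\<Union>\<phi>\<in>A. fst \<phi>) = topspace X \<and>
     (\<forall>\<phi>\<in>A. \<forall>\<psi>\<in>A. holomorphic_map_on (overlap \<phi> \<psi>) (transition \<phi> \<psi>))"

definition smooth_function :: "('a, 'n::finite) chart set \<Rightarrow> ('a \<Rightarrow> real) \<Rightarrow> bool" where
  "smooth_function A u \<longleftrightarrow> (\<forall>\<phi>\<in>A. smooth_map_on (chart_image \<phi>) (u \<circ> chart_inv \<phi>))"


section \<open>Hermitian metrics\<close>

text \<open>Real tangent vectors at a point are represented, in a holomorphic chart, by vectors of
  \<open>complex^'n\<close>, viewed as a real vector space of dimension \<open>2 * CARD('n)\<close>; the complex
  structure \<open>J\<close> is then multiplication by \<open>\<i>\<close>.  Geometric objects on the manifold are given by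
  their local expressions in all charts of the atlas, subject to the transformation law under
  change of chart; their values off the chart images are irrelevant.\<close>

abbreviation J :: "complex^'n \<Rightarrow> complex^'n" where
  "J v \<equiv> \<i> *s v"

type_synonym ('a, 'n) metric =
  "('a, 'n) chart \<Rightarrow> complex^'n \<Rightarrow> complex^'n \<Rightarrow> complex^'n \<Rightarrow> real"

definition hermitian_metric :: "('a, 'n::finite) chart set \<Rightarrow> ('a, 'n) metric \<Rightarrow> bool" where
  "hermitian_metric A g \<longleftrightarrow>
     (\<forall>\<phi>\<in>A. \<forall>x\<in>chart_image \<phi>.
        bilinear (g \<phi> x) \<and>
        (\<forall>v w. g \<phi> x v w = g \<phi> x w v) \<and>
        (\<forall>v. v \<noteq> 0 \<longrightarrow> g \<phi> x v v > 0) \<and>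
        (\<forall>v w. g \<phi> x (J v) (J w) = g \<phi> x v w)) \<and>
     (\<forall>\<phi>\<in>A. \<forall>v w. smooth_map_on (chart_image \<phi>) (\<lambda>x. g \<phi> x v w)) \<and>
     (\<forall>\<phi>\<in>A. \<forall>\<psi>\<in>A. \<forall>x\<in>overlap \<phi> \<psi>. \<forall>v w.
        let \<tau> = transition \<phi> \<psi>; D = frechet_derivative \<tau> (at x)
        in g \<phi> x v w = g \<psi> (\<tau> x) (D v) (D w))"

definition in_conformal_class ::
  "('a, 'n::finite) chart set \<Rightarrow> ('a, 'n) metric \<Rightarrow> ('a, 'n) metric \<Rightarrow> bool" where
  "in_conformal_class A g g' \<longleftrightarrow>
     (\<exists>u. smooth_function A u \<and>
        (\<forall>\<phi>\<in>A. \<forall>x\<in>chart_image \<phi>. \<forall>v w.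
           g' \<phi> x v w = exp (2 * u (chart_inv \<phi> x)) * g \<phi> x v w))"


section \<open>Affine connections\<close>

text \<open>In a chart, a connection on the tangent bundle is
  \<open>\<nabla>\<^sub>v Y = frechet_derivative Y (at x) v + \<Gamma> \<phi> x v (Y x)\<close>; the last conjunct below says
  that this expression transforms as a tangent vector.\<close>

type_synonym ('a, 'n) christoffel =
  "('a, 'n) chart \<Rightarrow> complex^'n \<Rightarrow> complex^'n \<Rightarrow> complex^'n \<Rightarrow> complex^'n"

definition connection :: "('a, 'n::finite) chart set \<Rightarrow> ('a, 'n) christoffel \<Rightarrow> bool" where
  "connection A \<Gamma> \<longleftrightarrow>
     (\<forall>\<phi>\<in>A. \<forall>x\<in>chart_image \<phi>. bilinear (\<Gamma> \<phi> x)) \<and>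
     (\<forall>\<phi>\<in>A. \<forall>v w. smooth_map_on (chart_image \<phi>) (\<lambda>x. \<Gamma> \<phi> x v w)) \<and>
     (\<forall>\<phi>\<in>A. \<forall>\<psi>\<in>A. \<forall>x\<in>overlap \<phi> \<psi>. \<forall>v w.
        let \<tau> = transition \<phi> \<psi>; D = frechet_derivative \<tau> (at x)
        in D (\<Gamma> \<phi> x v w) =
             frechet_derivative (\<lambda>y. frechet_derivative \<tau> (at y) w) (at x) v
             + \<Gamma> \<psi> (\<tau> x) (D v) (D w))"

text \<open>The next four definitions are the coordinate expressions at \<open>x\<close> of
  \<open>(\<nabla>\<^sub>v g)(a, b)\<close>, \<open>(\<nabla>\<^sub>v J) a\<close>, \<open>T(v, w)\<close> and \<open>R(v, w) a\<close>.
  No derivative of \<open>J\<close> and no Lie bracket appears, since \<open>J\<close> is constant in a holomorphic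
  chart and \<open>v\<close>, \<open>w\<close>, \<open>a\<close>, \<open>b\<close> are extended to constant vector fields.\<close>

definition nabla_metric ::
  "(complex^'n \<Rightarrow> complex^'n \<Rightarrow> complex^'n \<Rightarrow> complex^'n) \<Rightarrow>
   (complex^'n \<Rightarrow> complex^'n \<Rightarrow> complex^'n \<Rightarrow> real) \<Rightarrow>
   complex^'n \<Rightarrow> complex^'n \<Rightarrow> complex^'n \<Rightarrow> complex^'n \<Rightarrow> real" where
  "nabla_metric \<Gamma> g x v a b =
     frechet_derivative (\<lambda>y. g y a b) (at x) v - g x (\<Gamma> x v a) b - g x a (\<Gamma> x v b)"

definition nabla_J ::
  "(complex^'n \<Rightarrow> complex^'n \<Rightarrow> complex^'n \<Rightarrow> complex^'n) \<Rightarrow>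
   complex^'n \<Rightarrow> complex^'n \<Rightarrow> complex^'n \<Rightarrow> complex^'n" where
  "nabla_J \<Gamma> x v a = \<Gamma> x v (J a) - J (\<Gamma> x v a)"

definition torsion ::
  "(complex^'n \<Rightarrow> complex^'n \<Rightarrow> complex^'n \<Rightarrow> complex^'n) \<Rightarrow>
   complex^'n \<Rightarrow> complex^'n \<Rightarrow> complex^'n \<Rightarrow> complex^'n" where
  "torsion \<Gamma> x v w = \<Gamma> x v w - \<Gamma> x w v"

definition curvature ::
  "(complex^'n \<Rightarrow> complex^'n \<Rightarrow> complex^'n \<Rightarrow> complex^'n) \<Rightarrow>
   complex^'n \<Rightarrow> complex^'n \<Rightarrow> complex^'n \<Rightarrow> complex^'n \<Rightarrow> complex^'n" where
  "curvature \<Gamma> x v w a =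
     frechet_derivative (\<lambda>y. \<Gamma> y w a) (at x) v - frechet_derivative (\<lambda>y. \<Gamma> y v a) (at x) w
     + \<Gamma> x v (\<Gamma> x w a) - \<Gamma> x w (\<Gamma> x v a)"


section \<open>Strominger Kaehler-like metrics\<close>

definition totally_skew :: "('v \<Rightarrow> 'v \<Rightarrow> 'v \<Rightarrow> real) \<Rightarrow> bool" where
  "totally_skew t \<longleftrightarrow> (\<forall>a b c. t a b c = - t b a c \<and> t a b c = - t a c b)"

definition strominger_connection ::
  "('a, 'n::finite) chart set \<Rightarrow> ('a, 'n) metric \<Rightarrow> ('a, 'n) christoffel \<Rightarrow> bool" where
  "strominger_connection A g \<Gamma> \<longleftrightarrow>
     connection A \<Gamma> \<and>
     (\<forall>\<phi>\<in>A. \<forall>x\<in>chart_image \<phi>.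
        (\<forall>v a b. nabla_metric (\<Gamma> \<phi>) (g \<phi>) x v a b = 0) \<and>
        (\<forall>v a. nabla_J (\<Gamma> \<phi>) x v a = 0) \<and>
        totally_skew (\<lambda>a b c. g \<phi> x (torsion (\<Gamma> \<phi>) x a b) c))"

definition kaehler_symmetries ::
  "(complex^'n \<Rightarrow> complex^'n \<Rightarrow> complex^'n \<Rightarrow> complex^'n \<Rightarrow> real) \<Rightarrow> bool" where
  "kaehler_symmetries R \<longleftrightarrow>
     (\<forall>x y z w. R x y z w + R y z x w + R z x y w = 0 \<and>
        R x y z w = R (J x) (J y) z w \<and> R x y z w = R x y (J z) (J w))"

text \<open>The Strominger connection of a Hermitian metric is unique (proved below), so the
  existential quantifier merely names it.\<close>

definition strominger_kaehler_like ::
  "('a, 'n::finite) chart set \<Rightarrow> ('a, 'n) metric \<Rightarrow> bool" where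
  "strominger_kaehler_like A g \<longleftrightarrow>
     (\<exists>\<Gamma>. strominger_connection A g \<Gamma> \<and>
        (\<forall>\<phi>\<in>A. \<forall>x\<in>chart_image \<phi>.
           kaehler_symmetries (\<lambda>a b c d. g \<phi> x (curvature (\<Gamma> \<phi>) x a b c) d)))"

lemma skew_J_invariant_zero:
  fixes t :: "complex^'n \<Rightarrow> complex^'n \<Rightarrow> complex^'n \<Rightarrow> real"
  assumes s12: "\<And>a b c. t a b c = - t b a c" and s23: "\<And>a b c. t a b c = - t a c b"
    and inv: "\<And>a b c. t a (J b) (J c) = t a b c"
    and neg: "\<And>a b c. t a b (- c) = - t a b c"
  shows "t a b c = 0"
proof -
  have JJ: "J (J v) = - v" for v :: "complex^'n"
    by (simp add: vec_eq_iff)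
  have inv12: "t (J a) (J b) c = t a b c" for a b c
    by (metis s12 s23 inv)
  have inv13: "t (J a) b (J c) = t a b c" for a b c
    by (metis s12 inv)
  have move: "t (J a) b c = t a b (J c)" for a b c
    by (metis inv inv12)
  have "t a b c = t (J a) b (J c)" by (simp add: inv13)
  also have "\<dots> = t a b (J (J c))" by (rule move)
  also have "\<dots> = - t a b c" by (simp only: JJ neg)
  finally show ?thesis by simp
qed

theorem strominger_connection_unique:
  assumes g: "hermitian_metric A g"
    and 1: "strominger_connection A g \<Gamma>" and 2: "strominger_connection A g \<Gamma>'"
    and \<phi>: "\<phi> \<in> A" and x: "x \<in> chart_image \<phi>"
  shows "\<Gamma> \<phi> x v w = \<Gamma>' \<phi> x v w"
proof -
  let ?G = "g \<phi> x"
  have bil: "bilinear ?G" and sym: "\<And>v w. ?G v w = ?G w v"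
    and pos: "\<And>v. v \<noteq> 0 \<Longrightarrow> ?G v v > 0" and Jinv: "\<And>v w. ?G (J v) (J w) = ?G v w"
    using g \<phi> x unfolding hermitian_metric_def by blast+
  define B where "B a b = \<Gamma> \<phi> x a b - \<Gamma>' \<phi> x a b" for a b
  define t where "t a b c = ?G (B a b) c" for a b c
  note lin = bilinear_lsub[OF bil] bilinear_rsub[OF bil] bilinear_rneg[OF bil] bilinear_lneg[OF bil]
  have m: "nabla_metric (\<Gamma> \<phi>) (g \<phi>) x v a b = 0" "nabla_metric (\<Gamma>' \<phi>) (g \<phi>) x v a b = 0"
    "nabla_J (\<Gamma> \<phi>) x v a = 0" "nabla_J (\<Gamma>' \<phi>) x v a = 0" for v a b
    using 1 2 \<phi> x unfolding strominger_connection_def by blast+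
  have sk: "totally_skew (\<lambda>a b c. ?G (torsion (\<Gamma> \<phi>) x a b) c)"
    "totally_skew (\<lambda>a b c. ?G (torsion (\<Gamma>' \<phi>) x a b) c)"
    using 1 2 \<phi> x unfolding strominger_connection_def by blast+
  have s23: "t a b c = - t a c b" for a b c
    using m(1,2)[of a b c] sym[of b] unfolding nabla_metric_def t_def B_def by (simp add: lin)
  have tor: "t a b c - t b a c = - (t a c b - t c a b)" for a b c
    using sk[unfolded totally_skew_def, rule_format, of a b c]
    unfolding torsion_def t_def B_def by (simp add: lin)
  have s13: "t a b c = - t c b a" for a b c
    using tor[of b a c] s23[of b a c] by simp
  have s12: "t a b c = - t b a c" for a b c
    using s13 s23 by metis
  have "B a (J b) = J (B a b)" for a b
    using m(3,4)[of a b] unfolding nabla_J_def B_def by (simp add: vector_sub_rdistrib)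
  then have inv: "t a (J b) (J c) = t a b c" for a b c
    by (simp add: t_def Jinv)
  have "t v w (B v w) = 0"
    by (rule skew_J_invariant_zero[of t, OF s12 s23 inv]) (simp add: t_def lin)
  then have "B v w = 0"
    using pos[of "B v w"] unfolding t_def by force
  then show ?thesis by (simp add: B_def)
qed

end

theory Submission
  imports Defs
begin

text \<open>Write \<open>g\<^sub>2 = exp (2 * u) * g\<^sub>1\<close>; the claim is that \<open>du\<close> vanishes.  For an SKL metric with
  torsion \<open>T\<close>, the Bianchi identity makes \<open>\<nabla>T\<close> (lowered by the metric) a 4-form, equal to
  \<open>-1/3\<close> times the cyclic sum of \<open>g(T(a, b), T(c, d))\<close>; since \<open>T\<close> has no \<open>(3,0)\<close> part, this
  form has type \<open>(2,2)\<close>, so the complex bilinear part \<open>C\<close> of \<open>T\<close> satisfies \<open>\<nabla>\<^sub>v C = 0\<close> for \<open>v\<close> of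
  type \<open>(1,0)\<close>.  Under a conformal change \<open>C\<close> is altered by \<open>\<mu> \<and> id\<close> with \<open>\<mu>\<close> the \<open>(1,0)\<close> part of
  \<open>du\<close>, up to a factor.  Subtracting the two equations gives a pointwise algebraic identity which,
  where \<open>\<mu>\<close> does not vanish and \<open>n \<ge> 3\<close>, forces \<open>C(x, y) = h(x) y - h(y) x\<close> for both metrics.
  Then \<open>T\<close> corresponds to \<open>\<eta> \<and> \<omega>\<close> and \<open>\<nabla>T\<close> to \<open>\<kappa> \<and> \<omega>\<close>, and evaluating the 4-form identity on two
  \<open>J\<close>-invariant planes yields \<open>\<eta> = 0\<close>.  Hence \<open>C = 0\<close> for both metrics, and so \<open>\<mu> = 0\<close>.\<close>

section \<open>Hermitian forms and SKL jets at a point\<close>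

lemma J_simps [simp]:
  fixes a b :: "complex^'n"
  shows "J (a + b) = J a + J b" "J (a - b) = J a - J b" "J (- a) = - J a"
    "J (J a) = - a" "J 0 = 0" "J (r *\<^sub>R a) = r *\<^sub>R J a"
  by (auto simp: vec_eq_iff algebra_simps)

text \<open>Merging nested scalars would hide \<open>J (J a)\<close> from
  \<open>J_simps\<close>.\<close>

declare vector_smult_assoc [simp del]

lemmas bilinear_expand = bilinear_ladd bilinear_radd bilinear_lsub bilinear_rsub bilinear_lneg
  bilinear_rneg bilinear_lzero bilinear_rzero bilinear_lmul bilinear_rmul

locale hermitian_form =
  fixes G :: "complex^'n \<Rightarrow> complex^'n \<Rightarrow> real"
  assumes bil: "bilinear G" and sym: "G v w = G w v" and pos: "v \<noteq> 0 \<Longrightarrow> G v v > 0"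
    and J_inv: "G (J v) (J w) = G v w"
begin

lemmas G_expand [simp] = bilinear_expand[OF bil]

lemma G_J_left: "G (J v) w = - G v (J w)"
  using J_inv[of v "J w"] by simp

lemma eqI: "(\<And>c. G v c = G w c) \<Longrightarrow> v = w"
  using pos[of "v - w"] by force

end

definition tors :: "('v \<Rightarrow> 'v \<Rightarrow> 'v::group_add) \<Rightarrow> 'v \<Rightarrow> 'v \<Rightarrow> 'v" where
  "tors \<Gamma> a b = \<Gamma> a b - \<Gamma> b a"

text \<open>The covariant derivative of a tensor field \<open>B\<close> of type \<open>(2,1)\<close> at a point, where \<open>DB v\<close> is the
  ordinary directional derivative of \<open>B\<close>.\<close>

definition cov :: "('v \<Rightarrow> 'v \<Rightarrow> 'v) \<Rightarrow> ('v \<Rightarrow> 'v \<Rightarrow> 'v \<Rightarrow> 'v) \<Rightarrow> ('v \<Rightarrow> 'v \<Rightarrow> 'v)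
    \<Rightarrow> 'v \<Rightarrow> 'v \<Rightarrow> 'v \<Rightarrow> 'v::group_add" where
  "cov \<Gamma> DB B v a b = DB v a b + \<Gamma> v (B a b) - B (\<Gamma> v a) b - B a (\<Gamma> v b)"

text \<open>Twice the complex linear part in the first argument; leaving out the factor \<open>1/2\<close> does no harm
  because the identities below are homogeneous.\<close>

definition hol :: "(complex^'n \<Rightarrow> complex^'n \<Rightarrow> complex^'n) \<Rightarrow> complex^'n \<Rightarrow> complex^'n \<Rightarrow> complex^'n" where
  "hol \<Gamma> v y = \<Gamma> v y - J (\<Gamma> (J v) y)"

text \<open>For a connection with \<open>\<nabla>J = 0\<close> this is twice the complex bilinear part of its torsion.\<close>

abbreviation hol_tors where "hol_tors \<Gamma> \<equiv> tors (hol \<Gamma>)"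

text \<open>The 1-jet at a point of the Strominger connection of an SKL metric: \<open>\<Gamma> v a\<close> is the Christoffel
  term and \<open>D v a b\<close> the derivative of \<open>\<Gamma> a b\<close> in the direction \<open>v\<close>.\<close>

locale skl_jet = hermitian_form G
  for G :: "complex^'n \<Rightarrow> complex^'n \<Rightarrow> real" +
  fixes \<Gamma> :: "complex^'n \<Rightarrow> complex^'n \<Rightarrow> complex^'n"
    and D :: "complex^'n \<Rightarrow> complex^'n \<Rightarrow> complex^'n \<Rightarrow> complex^'n"
  assumes bil_\<Gamma>: "bilinear \<Gamma>" and \<Gamma>_J [simp]: "\<Gamma> v (J a) = J (\<Gamma> v a)"
    and bil_D: "bilinear (D v)" and D_J [simp]: "D v a (J b) = J (D v a b)"
    and tors_skew: "totally_skew (\<lambda>a b c. G (tors \<Gamma> a b) c)"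
    and cov_skew: "totally_skew (\<lambda>a b c. G (cov \<Gamma> (\<lambda>v. tors (D v)) (tors \<Gamma>) v a b) c)"
    and bianchi: "let R = (\<lambda>v w a. D v w a - D w v a + \<Gamma> v (\<Gamma> w a) - \<Gamma> w (\<Gamma> v a))
      in G (R x y z) w + G (R y z x) w + G (R z x y) w = 0"
begin

abbreviation T where "T \<equiv> tors \<Gamma>"
abbreviation C where "C \<equiv> hol_tors \<Gamma>"
abbreviation nT where "nT \<equiv> cov \<Gamma> (\<lambda>v. tors (D v)) T"
abbreviation nC where "nC \<equiv> cov \<Gamma> (\<lambda>v. hol_tors (D v)) C"

definition \<phi> where "\<phi> v a b c = G (nT v a b) c"
definition \<sigma> where "\<sigma> a b c d = G (T a b) (T c d) + G (T b c) (T a d) + G (T c a) (T b d)"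

lemmas \<Gamma>_expand [simp] = bilinear_expand[OF bil_\<Gamma>]
lemmas D_expand [simp] = bilinear_expand[OF bil_D]

lemma T_skew: "G (T a b) c = - G (T b a) c" "G (T a b) c = - G (T a c) b"
  using tors_skew unfolding totally_skew_def by blast+

lemma \<phi>_skew: "\<phi> v a b c = - \<phi> v b a c" "\<phi> v a b c = - \<phi> v a c b"
  using cov_skew[of v] unfolding totally_skew_def \<phi>_def by blast+

lemma T_lin [simp]: "T (a + b) c = T a c + T b c" "T c (a + b) = T c a + T c b"
   "T (a - b) c = T a c - T b c" "T c (a - b) = T c a - T c b"
  "T (- a) c = - T a c" "T c (- a) = - T c a" "T 0 c = 0" "T c 0 = 0"
  by (simp_all add: tors_def)

text \<open>Integrability of the complex structure: for a connection preserving \<open>J\<close>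
  this is the vanishing of the Nijenhuis tensor, written with the torsion.\<close>

lemma T_type: "T (J a) (J b) = T a b + J (T (J a) b) + J (T a (J b))"
  by (simp add: tors_def algebra_simps)

lemma nT_type: "nT v (J a) (J b) = nT v a b + J (nT v (J a) b) + J (nT v a (J b))"
  by (simp add: tors_def cov_def algebra_simps)

text \<open>For a form alternating in \<open>a\<close>, \<open>b\<close>, \<open>c\<close> this
  means that its (3,0) and (0,3) parts vanish.\<close>

lemma \<phi>_type: "\<phi> v a b c = \<phi> v (J a) (J b) c + \<phi> v (J a) b (J c) + \<phi> v a (J b) (J c)"
  unfolding \<phi>_def nT_type by (simp add: G_J_left)

lemma C_eq: "C a b = T a b - T (J a) (J b)"
  by (simp add: tors_def hol_def algebra_simps)

lemma C_J [simp]: "C (J a) b = J (C a b)" "C a (J b) = J (C a b)"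
  by (simp_all add: tors_def hol_def algebra_simps)

lemma C_lin [simp]: "C (a + b) c = C a c + C b c" "C c (a + b) = C c a + C c b"
   "C (a - b) c = C a c - C b c" "C c (a - b) = C c a - C c b"
  "C (- a) c = - C a c" "C c (- a) = - C c a" "C 0 c = 0" "C c 0 = 0"
  by (simp_all add: C_eq)

lemma nC_eq: "nC v a b = nT v a b - nT v (J a) (J b)"
  by (simp add: cov_def tors_def hol_def algebra_simps)

text \<open>First Bianchi identity of a connection with torsion; \<open>bianchi\<close> removes the
  curvature terms.\<close>

lemma cyclic: "\<phi> v w a d + \<phi> w a v d + \<phi> a v w d = - \<sigma> v w a d"
proof -
  \<comment> \<open>Total skewness moves the outer torsion to the other side, which turns the
    quadratic Bianchi terms into \<open>\<sigma>\<close>.\<close>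
  have *: "G (T (T x y) z) d = G (T x y) (T z d)" for x y z
    using T_skew(1)[of "T x y" z d] T_skew(2)[of z "T x y" d] sym[of "T x y"] by simp
  have "nT v w a + nT w a v + nT a v w =
     (D v w a - D w v a + \<Gamma> v (\<Gamma> w a) - \<Gamma> w (\<Gamma> v a))
   + (D w a v - D a w v + \<Gamma> w (\<Gamma> a v) - \<Gamma> a (\<Gamma> w v))
   + (D a v w - D v a w + \<Gamma> a (\<Gamma> v w) - \<Gamma> v (\<Gamma> a w))
   - (T (T v w) a + T (T w a) v + T (T a v) w)"
    by (simp add: cov_def tors_def algebra_simps)
  then have "\<phi> v w a d + \<phi> w a v d + \<phi> a v w d = - (G (T (T v w) a) d + G (T (T w a) v) d + G (T (T a v) w) d)"
    using bianchi[of v w a d] unfolding \<phi>_def Let_def G_expand(1)[symmetric] by (simp del: \<Gamma>_expand D_expand)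
  then show ?thesis
    by (simp add: * \<sigma>_def)
qed

text \<open>The four instances of \<open>cyclic\<close> say that any three of the four terms
  \<open>\<phi> v a b c\<close>, \<open>- \<phi> a v b c\<close>, \<open>\<phi> b v a c\<close>, \<open>- \<phi> c v a b\<close> add up to \<open>- \<sigma> v a b c\<close>.\<close>

lemma \<phi>_eq: "3 * \<phi> v a b c = - \<sigma> v a b c"
proof -
  have T_swap: "T y x = - T x y" for x y by (simp add: tors_def)
  \<comment> \<open>The right-hand sides of the four instances agree up to sign, so comparing them
    makes all four terms equal.\<close>
  have s: "\<sigma> a b c v = - \<sigma> v a b c" "\<sigma> b c v a = \<sigma> v a b c" "\<sigma> c v a b = - \<sigma> v a b c"
    unfolding \<sigma>_def by (simp_all add: T_swap[of c a] T_swap[of v a] T_swap[of v b] T_swap[of v c]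
        T_swap[of b a] T_swap[of c b] sym)
  show ?thesis
    using cyclic[of v a b c] cyclic[of a b c v] cyclic[of b c v a] cyclic[of c v a b] s \<phi>_skew
    by (smt (verit))
qed

lemma \<sigma>_swap: "\<sigma> a b c d = - \<sigma> b a c d"
proof -
  have T_swap: "T y x = - T x y" for x y by (simp add: tors_def)
  show ?thesis
    unfolding \<sigma>_def by (simp add: T_swap[of b a] T_swap[of c a] T_swap[of c b] sym)
qed

text \<open>With \<open>\<phi>_skew\<close> this makes \<open>\<phi>\<close> a 4-form.\<close>

lemma \<phi>_swap: "\<phi> v a b c = - \<phi> a v b c"
  using \<phi>_eq[of v a b c] \<phi>_eq[of a v b c] \<sigma>_swap[of v a b c] by linarith

text \<open>Since \<open>\<phi>\<close> is a 4-form, \<open>\<phi>_type\<close> applies to any three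
  of its arguments, so \<open>\<phi>\<close> has type (2,2). Here the triples \<open>a, b, c\<close>
  and \<open>v, a, b\<close> are used.\<close>

lemma nC_conj: "nC (J v) a b = - J (nC v a b)"
proof (rule eqI)
  fix c
  have "\<phi> v a b (J c) = \<phi> (J v) (J a) b (J c) + \<phi> (J v) a (J b) (J c) + \<phi> v (J a) (J b) (J c)"
    using \<phi>_type[of "J c" v a b] \<phi>_swap \<phi>_skew by (smt (verit))
  then have "\<phi> (J v) a b c - \<phi> (J v) (J a) (J b) c = \<phi> v a b (J c) - \<phi> v (J a) (J b) (J c)"
    using \<phi>_type[of "J v" a b c] by simp
  then show "G (nC (J v) a b) c = G (- J (nC v a b)) c"
    unfolding nC_eq \<phi>_def by (simp add: G_J_left)
qed

text \<open>The complex linear part in \<open>v\<close> of \<open>nC v\<close> vanishes; written out, only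
  the complex bilinear part of the connection enters.\<close>

lemma hol_tors_eq:
  "hol_tors (D v) x y - J (hol_tors (D (J v)) x y) + hol \<Gamma> v (C x y)
     - C (hol \<Gamma> v x) y - C x (hol \<Gamma> v y) = 0"
proof -
  have "nC v x y - J (nC (J v) x y) = 0"
    by (simp add: nC_conj)
  then show ?thesis
    unfolding cov_def hol_def[of \<Gamma> v x] hol_def[of \<Gamma> v y] hol_def[of \<Gamma> v "C x y"]
    by (simp add: algebra_simps)
qed

text \<open>By \<open>C_eq\<close> the cyclic sum is three copies of the lowered torsion minus its
  \<open>J\<close>-rotated terms, and these add up to one copy because there is no (3,0) part. The
  same count gives \<open>two_\<phi>\<close>.\<close>

lemma two_tors: "2 * G (T a b) c = G (C a b) c + G (C b c) a + G (C c a) b"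
proof -
  have *: "G (T (J a) (J b)) c + G (T (J b) (J c)) a + G (T (J c) (J a)) b = G (T a b) c"
    using T_type[of a b] T_skew
    by (smt (verit) G_J_left G_expand)
  show ?thesis
    using * T_skew unfolding C_eq by (smt (verit) G_expand)
qed

lemma two_\<phi>: "2 * \<phi> v a b c = G (nC v a b) c + G (nC v b c) a + G (nC v c a) b"
proof -
  have *: "\<phi> v (J a) (J b) c + \<phi> v (J b) (J c) a + \<phi> v (J c) (J a) b = \<phi> v a b c"
    using \<phi>_type[of v a b c] \<phi>_skew by (smt (verit))
  have "G (nC v x y) z = \<phi> v x y z - \<phi> v (J x) (J y) z" for x y z
    unfolding nC_eq \<phi>_def by simp
  then show ?thesis
    using * \<phi>_skew by (smt (verit))
qed

end

section \<open>Torsion of the form \<open>h\<close> wedge identity\<close>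

text \<open>Count of real dimensions: at least 6 against 4. It yields vectors in the kernel of a
  linear form that are also orthogonal to a given complex line.\<close>

lemma common_kernel:
  fixes f :: "complex^'n \<Rightarrow> complex \<times> complex"
  assumes "linear f" and "CARD('n) \<ge> 3"
  obtains x where "x \<noteq> 0" "f x = 0"
proof -
  have "\<not> inj f"
  proof
    assume "inj f"
    then have "DIM(complex^'n) \<le> DIM(complex \<times> complex)"
      using dim_image_eq[OF assms(1), of UNIV] dim_subset_UNIV[of "range f"] by (simp add: inj_on_def)
    then show False
      using assms(2) by simp
  qed
  then show ?thesis
    using that assms(1) linear_injective_0 by blast
qed

lemma complex_smult: "(z::complex) *s v = Re z *\<^sub>R v + Im z *\<^sub>R J v"
  by (simp add: vec_eq_iff complex_eq_iff)

context skl_jet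
begin

lemma wedge_form_zero:
  assumes n: "CARD('n) \<ge> 3"
    and h: "linear h" "\<And>x. h (J x) = \<i> * h x"
    and C: "\<And>x y. C x y = h x *s y - h y *s x"
    and nC: "\<And>v x y. nC v x y = k v x *s y - k v y *s x"
  shows "h x = 0"
proof -
  define \<eta> where "\<eta> x = Im (h x)" for x
  define \<kappa> where "\<kappa> v x = Im (k v x)" for v x
  define \<omega> where "\<omega> x y = G (J x) y" for x y
  have \<omega>: "\<omega> x y = - \<omega> y x" for x y
    unfolding \<omega>_def using G_J_left sym by metis
  \<comment> \<open>In the cyclic sum the real parts of \<open>h\<close> cancel by symmetry of
    \<open>G\<close>; the imaginary parts, paired with \<open>\<omega>\<close>, appear
    twice.\<close>
  have \<tau>: "G (T a b) c = \<eta> a * \<omega> b c + \<eta> b * \<omega> c a + \<eta> c * \<omega> a b" for a b c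
    using two_tors[of a b c] sym[of a b] sym[of b c] sym[of a c] \<omega>[of a b] \<omega>[of b c] \<omega>[of a c]
    unfolding C by (simp add: complex_smult[of "h _"] \<eta>_def \<omega>_def)
  have \<phi>: "\<phi> v a b c = \<kappa> v a * \<omega> b c + \<kappa> v b * \<omega> c a + \<kappa> v c * \<omega> a b" for v a b c
    using two_\<phi>[of v a b c] sym[of a b] sym[of b c] sym[of a c] \<omega>[of a b] \<omega>[of b c] \<omega>[of a c]
    unfolding nC by (simp add: complex_smult[of "k _ _"] \<kappa>_def \<omega>_def)
  obtain w1 where w1: "w1 \<noteq> 0" "h w1 = 0"
    using common_kernel[of "\<lambda>x. (h x, 0)"] n h(1)
    by (auto simp: linear_iff zero_prod_def)
  \<comment> \<open>The second component vanishes exactly on the orthogonal complement of the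
    complex line of \<open>w1\<close>.\<close>
  have "linear (\<lambda>x. (h x, Complex (G w1 x) (G (J w1) x)))"
    using h(1) by (auto simp: linear_iff complex_eq_iff)
  then obtain w2 where w2: "w2 \<noteq> 0" "h w2 = 0" "G w1 w2 = 0" "G (J w1) w2 = 0"
    using n by (elim common_kernel) (auto simp: complex_eq_iff zero_prod_def)
  define a where "a = G w1 w1"
  define b where "b = G w2 w2"
  have ab: "a > 0" "b > 0" using pos w1 w2 by (auto simp: a_def b_def)
  \<comment> \<open>\<open>N\<close> is the vector dual to \<open>\<eta>\<close>.\<close>
  define N where "N = (1 / a) *\<^sub>R T w1 (J w1)"
  have \<eta>w: "\<eta> w1 = 0" "\<eta> (J w1) = 0" "\<eta> w2 = 0" "\<eta> (J w2) = 0"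
    using w1 w2 h(2) by (auto simp: \<eta>_def)
  have N: "G N c = \<eta> c" for c
    using ab by (simp add: N_def \<tau> \<eta>w \<omega>_def J_inv flip: a_def)
  have T: "T x y = \<eta> x *\<^sub>R J y - \<eta> y *\<^sub>R J x + \<omega> x y *\<^sub>R N" for x y
    by (rule eqI) (simp add: \<tau> N \<omega>[of _ x] flip: \<omega>_def)
  have G0: "G w1 N = 0" "G (J w1) N = 0" "G w1 (J N) = 0" "G (J w1) (J N) = 0"
    "G N w1 = 0" "G N (J w1) = 0"
    using N \<eta>w J_inv[of w1 N] G_J_left[of w1 N] sym[of w1 N] sym[of "J w1" N]by (simp_all add: sym[of _ N])
  have NN: "G N (J N) = 0" "G (J N) N = 0"
    using G_J_left[of N N] sym[of N "J N"] by auto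
  have w: "G w1 (J w2) = 0" "G w2 w1 = 0" "G w2 (J w1) = 0" "G (J w2) w1 = 0"
    "G w1 (J w1) = 0" "G w2 (J w2) = 0" "G (J w1) w1 = 0" "G (J w2) w2 = 0"
    using w2 G_J_left[of w1 w2] G_J_left[of w2 w1] G_J_left[of w1 w1] G_J_left[of w2 w2] sym[of "J w1" w1] sym[of "J w2" w2]
      sym[of w1 w2] sym[of "J w1" w2] sym[of w1 "J w2"]
    by auto
  have \<eta>N: "\<eta> N = G N N" "\<eta> (J N) = 0"
    using N NN by metis+
  \<comment> \<open>On \<open>(w1, J w1, w2, J w2)\<close> the identity \<open>3 \<phi> = - \<sigma>\<close> gives \<open>3 \<kappa>(w1, J w1) = - \<bar>w1\<bar>\<^sup>2 \<bar>N\<bar>\<^sup>2\<close>,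
    on \<open>(w1, J w1, N, J N)\<close> it gives \<open>\<kappa>(w1, J w1) \<bar>N\<bar>\<^sup>2 = 0\<close>.\<close>
  have "\<phi> w1 (J w1) w2 (J w2) = \<kappa> w1 (J w1) * b"
    by (simp add: \<phi> \<omega>_def b_def J_inv w w2)
  moreover have "\<sigma> w1 (J w1) w2 (J w2) = a * b * G N N"
    by (simp add: \<sigma>_def T \<eta>w \<omega>_def J_inv w w2 a_def b_def)
  ultimately have "b * (3 * \<kappa> w1 (J w1) + a * G N N) = 0"
    using \<phi>_eq[of w1 "J w1" w2 "J w2"] by (simp add: algebra_simps)
  then have 1: "3 * \<kappa> w1 (J w1) + a * G N N = 0"
    using ab by simp
  have "\<phi> w1 (J w1) N (J N) = \<kappa> w1 (J w1) * G N N"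
    by (simp add: \<phi> \<omega>_def J_inv G0 sym[of "J N"])
  moreover have "\<sigma> w1 (J w1) N (J N) = 0"
    by (simp add: \<sigma>_def T \<eta>w \<eta>N \<omega>_def J_inv G0 NN sym[of "J N"] sym[of N "J w1"] sym[of N w1])
  ultimately have "\<kappa> w1 (J w1) * G N N = 0"
    using \<phi>_eq[of w1 "J w1" N "J N"] by simp
  then have "G N N = 0" using 1 ab by auto
  then have "N = 0" using pos[of N] by force
  then have "Im (h x) = 0" for x using N[of x] by (simp add: \<eta>_def)
  \<comment> \<open>The imaginary part of \<open>h (J x) = \<i> * h x\<close> is the real part of
    \<open>h x\<close>.\<close>
  from this[of x] this[of "J x"] show ?thesis
    by (simp add: h(2) complex_eq_iff)
qed

end

section \<open>Linear algebra of the subtracted equations\<close>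

lemma smult_simps:
  fixes a b :: "complex^'n"
  shows "z *s (a + b) = z *s a + z *s b" "z *s (a - b) = z *s a - z *s b"
    "(z + w) *s a = z *s a + w *s a" "(z - w) *s a = z *s a - w *s a"
    "z *s (w *s a) = (z * w) *s a" "(- z) *s a = - (z *s a)" "z *s (- a) = - (z *s a)"
  by (simp_all add: vec_eq_iff algebra_simps)

lemma independent_in_kernel:
  fixes \<mu> :: "complex^'n \<Rightarrow> complex"
  assumes "linear \<mu>" and "CARD('n) \<ge> 3" and "v \<noteq> 0"
  obtains w where "\<mu> w = 0" "\<And>a b. a *s w + b *s v = 0 \<Longrightarrow> a = 0 \<and> b = 0"
proof -
  have "linear (\<lambda>x. (\<mu> x, Complex (x \<bullet> v) (x \<bullet> J v)))"
    using assms(1) by (auto simp: linear_iff complex_eq_iff inner_add_left)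
  then obtain w where w: "w \<noteq> 0" "\<mu> w = 0" "w \<bullet> v = 0" "w \<bullet> J v = 0"
    using assms(2) by (elim common_kernel) (auto simp: complex_eq_iff zero_prod_def)
  have "a = 0 \<and> b = 0" if ab: "a *s w + b *s v = 0" for a b
  proof -
    have "a = 0"
    proof (rule ccontr)
      assume "a \<noteq> 0"
      have "w = (1 / a) *s (a *s w + b *s v) - (b / a) *s v"
        using \<open>a \<noteq> 0\<close> by (simp add: vec_eq_iff field_simps)
      then have "w = - (b / a) *s v" unfolding ab by simp
      then have "w \<bullet> w = 0"
        using w(3,4) complex_smult[of "- (b / a)" v] by (metis inner_add_right inner_scaleR_right mult_zero_right add_0)
      then show False using w(1) by simp
    qed
    then show ?thesis using ab assms(3) by simp
  qed
  then show ?thesis using w(2) that by blast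
qed

text \<open>Split vectors along \<open>e\<close>, where \<open>\<mu> e = 1\<close>, and the kernel
  of \<open>\<mu>\<close>. Putting \<open>e\<close> into slots of \<open>eq\<close> expresses
  \<open>C\<close> through \<open>\<beta>\<close> and \<open>k\<close>; pairs of independent kernel
  vectors, available for n \<ge> 3, then determine the values of \<open>\<beta>\<close> that
  occur.\<close>

lemma wedge_form_of_eq:
  fixes C :: "complex^'n \<Rightarrow> complex^'n \<Rightarrow> complex^'n" and \<mu> :: "complex^'n \<Rightarrow> complex"
  assumes n: "CARD('n) \<ge> 3"
    and \<mu>: "linear \<mu>" "\<And>z x. \<mu> (z *s x) = z * \<mu> x" and "\<mu> p \<noteq> 0"
    and C_add: "\<And>a b c. C a (b + c) = C a b + C a c"
    and C_smult: "\<And>z a b. C a (z *s b) = z *s C a b"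
    and C_skew: "\<And>a b. C a b = - C b a"
    and eq: "\<And>v x y. \<beta> v y *s x - \<beta> v x *s y + \<mu> (C x y) *s v - \<mu> x *s C v y - \<mu> y *s C x v = 0"
  obtains h where "linear h" "\<And>z x. h (z *s x) = z * h x" "\<And>x y. C x y = h x *s y - h y *s x"
proof -
  define e where "e = (1 / \<mu> p) *s p"
  have \<mu>e: "\<mu> e = 1" using \<open>\<mu> p \<noteq> 0\<close> by (simp add: e_def \<mu>(2))
  note \<mu>_simps = linear_add[OF \<mu>(1)] linear_diff[OF \<mu>(1)] linear_neg[OF \<mu>(1)] linear_0[OF \<mu>(1)] \<mu>(2)
  have C_self: "C a a = 0" for a
    using C_skew[of a a] by (simp add: vec_eq_iff eq_neg_iff_add_eq_0)
  have C0: "C a 0 = 0" "C 0 a = 0" for a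
    using C_smult[of a 0 0] C_skew[of 0 a] by simp_all
  define k where "k y = \<mu> (C e y)" for y
  have a: "C e y = (\<beta> e y + k y) *s e - \<beta> e e *s y" for y
    using eq[of e y e] by (simp add: C_self \<mu>e smult_simps k_def algebra_simps)
  have b: "C v y = \<beta> v y *s e - \<beta> v e *s y + k y *s v" if "\<mu> v = 0" "\<mu> y = 0" for v y
    using eq[of v y e] that by (simp add: \<mu>e k_def algebra_simps)
  have c: "\<beta> e y *s x - \<beta> e x *s y + \<mu> (C x y) *s e = 0" if "\<mu> x = 0" "\<mu> y = 0" for x y
    using eq[of e y x] that by simp
  have d: "\<mu> (C x y) = 0" if "\<mu> x = 0" "\<mu> y = 0" for x y
    using arg_cong[OF c[OF that], of \<mu>] that by (simp add: \<mu>_simps \<mu>e)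
  have C_e: "C e y = k y *s e - \<beta> e e *s y" if y: "\<mu> y = 0" for y
  proof (cases "y = 0")
    case False
    \<comment> \<open>The kernel has complex dimension at least 2, so coefficients of
      \<open>x\<close> and \<open>y\<close> can be compared in \<open>c\<close>.\<close>
    obtain x where x: "\<mu> x = 0" "\<And>a b. a *s x + b *s y = 0 \<Longrightarrow> a = 0 \<and> b = 0"
      using independent_in_kernel[OF \<mu>(1) n False] by metis
    have "\<beta> e y *s x + (- \<beta> e x) *s y = 0"
      using c[OF x(1) y] d[OF x(1) y] by (simp add: smult_simps)
    then have "\<beta> e y = 0" using x(2) by blast
    then show ?thesis using a[of y] by simp
  qed (simp add: C0 k_def \<mu>_simps)
  have \<beta>0: "\<beta> v y = 0" if "\<mu> v = 0" "\<mu> y = 0" for v y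
    using arg_cong[OF b[OF that], of \<mu>] d[OF that] that by (simp add: \<mu>_simps \<mu>e)
  have \<beta>_e: "\<beta> v e = k v" if v: "\<mu> v = 0" and "v \<noteq> 0" for v
  proof -
    obtain x where x: "\<mu> x = 0" "\<And>a b. a *s x + b *s v = 0 \<Longrightarrow> a = 0 \<and> b = 0"
      using independent_in_kernel[OF \<mu>(1) n \<open>v \<noteq> 0\<close>] by metis
    \<comment> \<open>The two instances of \<open>b\<close> add up to zero because \<open>C\<close>
      is skew.\<close>
    have "(k v - \<beta> v e) *s x + (k x - \<beta> x e) *s v = 0"
      using b[OF v x(1)] b[OF x(1) v] \<beta>0[OF v x(1)] \<beta>0[OF x(1) v] C_skew[of v x]
      by (simp add: smult_simps algebra_simps)
    then show ?thesis using x(2) by fastforce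
  qed
  have C_ker: "C v y = k y *s v - k v *s y" if "\<mu> v = 0" "\<mu> y = 0" for v y
    using b[OF that] \<beta>0[OF that] \<beta>_e[OF that(1)] by (cases "v = 0") (simp_all add: C0 k_def \<mu>_simps)
  \<comment> \<open>Forced by \<open>C_ker\<close> and \<open>C_e\<close>: \<open>h = - k\<close> on
    the kernel and \<open>h e = - \<beta> e e\<close>.\<close>
  define h where "h x = - k x - \<mu> x * \<beta> e e" for x
  have k_lin: "k (x + y) = k x + k y" "k (z *s x) = z * k x" "k e = 0" for x y z
    by (simp_all add: k_def C_add C_smult C_self \<mu>_simps)
  have h_lin: "h (z *s x) = z * h x" "h (x + y) = h x + h y" for x y z
    by (simp_all add: h_def k_lin \<mu>_simps algebra_simps)
  have "linear h"
  proof (rule linearI)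
    fix r :: real and x
    show "h (r *\<^sub>R x) = r *\<^sub>R h x"
      using h_lin(1)[of "of_real r" x] complex_smult[of "of_real r" x]
      by (simp add: scaleR_conv_of_real)
  qed (rule h_lin)
  moreover have "C x y = h x *s y - h y *s x" for x y
  proof -
    define x' where "x' = x - \<mu> x *s e"
    define y' where "y' = y - \<mu> y *s e"
    have ker: "\<mu> x' = 0" "\<mu> y' = 0" by (simp_all add: x'_def y'_def \<mu>_simps \<mu>e)
    have x: "x = x' + \<mu> x *s e" and y: "y = y' + \<mu> y *s e" by (simp_all add: x'_def y'_def)
    have C_add': "C (b + c) a = C b a + C c a" for a b c
      using C_add[of a b c] C_skew by (metis minus_add_distrib)
    have C_smult': "C (z *s b) a = z *s C b a" for z a b
      using C_smult[of a z b] C_skew by (metis smult_simps(7))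
    have hx: "h x = - k x' - \<mu> x * \<beta> e e" "h y = - k y' - \<mu> y * \<beta> e e"
      using k_lin(1)[of x' "\<mu> x *s e"] k_lin(1)[of y' "\<mu> y *s e"] k_lin(2,3) by (simp_all add: h_def flip: x y)
    have "C x y = C x' y' - \<mu> y *s C e x' + \<mu> x *s C e y'"
      by (subst x, subst y) (simp add: C_add C_add' C_smult C_smult' C_self C_skew[of x' e] smult_simps)
    also have "\<dots> = h x *s (y' + \<mu> y *s e) - h y *s (x' + \<mu> x *s e)"
      unfolding C_ker[OF ker] C_e[OF ker(1)] C_e[OF ker(2)] hx
      by (simp add: smult_simps algebra_simps)
    finally show ?thesis
      by (simp flip: x y)
  qed
  ultimately show ?thesis using h_lin(1) that by blast
qed

section \<open>Effect of a conformal change on the connection and its torsion\<close>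

context hermitian_form
begin

text \<open>\<open>B\<close> is the difference of the two connections and \<open>l\<close> stands for \<open>du\<close>.\<close>

lemma conformal_change:
  assumes B_J: "\<And>x y. B x (J y) = J (B x y)"
    and compatible: "\<And>x y z. G (B x y) z + G y (B x z) = 2 * l x * G y z"
    and skew: "totally_skew (\<lambda>a b c. G (tors B a b) c)"
  shows "hol B x y = (2 * Complex (l y) (- l (J y))) *s x"
proof (rule eqI)
  fix z
  define f where "f x y z = G (B x y) z" for x y z
  have f1: "f x y z + f x z y = 2 * l x * G y z" for x y z
    using compatible[of x y z] sym[of y] by (simp add: f_def)
  have "f x y z - f y x z + f z y x - f y z x = 0" for x y z
    using skew[unfolded totally_skew_def, rule_format, of x y z]
      skew[unfolded totally_skew_def, rule_format, of y z x]
      skew[unfolded totally_skew_def, rule_format, of y x z]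
    by (simp add: f_def tors_def)
  \<comment> \<open>Skewness of the torsion in its outer arguments trades this sum for one covered
    by compatibility.\<close>
  then have f2: "f x y z + f z y x = 2 * l y * G x z" for x y z
    using f1[of y x z] by (smt (verit))
  have f3: "f x y (J z) = - f x (J y) z" for x y z
    using G_J_left by (simp add: f_def B_J)
  \<comment> \<open>The left side is \<open>f x y z - f (J x) (J y) z\<close>. Applying
    \<open>f2\<close> to both terms leaves \<open>f z y x\<close> and
    \<open>f z (J y) (J x)\<close>, which are equal by \<open>f3\<close> and cancel.\<close>
  show "G (hol B x y) z = G ((2 * Complex (l y) (- l (J y))) *s x) z"
    using f2[of x y z] f2[of "J x" "J y" z] f3[of "J x" y z] f3[of z "J y" x]
    by (simp add: hol_def G_J_left complex_smult[of "2 * Complex _ _"]) (simp add: f_def B_J G_J_left algebra_simps)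
qed

end

context skl_jet
begin

lemma complex_linear:
  assumes "\<And>a b. f (a + b) = f a + f b" "\<And>r a. f (r *\<^sub>R a) = r *\<^sub>R f a" "\<And>a. f (J a) = J (f a)"
  shows "f (z *s a) = z *s (f a :: complex^'n)"
  unfolding complex_smult[of z] by (simp add: assms)

lemma hol_lin [simp]: "hol \<Gamma> v (a + b) = hol \<Gamma> v a + hol \<Gamma> v b"
  "hol \<Gamma> v (a - b) = hol \<Gamma> v a - hol \<Gamma> v b" "hol \<Gamma> v (- a) = - hol \<Gamma> v a"
  "hol \<Gamma> v (z *s a) = z *s hol \<Gamma> v a"
proof -
  show "hol \<Gamma> v (z *s a) = z *s hol \<Gamma> v a"
    by (rule complex_linear[where f = "hol \<Gamma> v"]) (simp_all add: hol_def algebra_simps)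
qed (simp_all add: hol_def algebra_simps)

lemma C_skew: "C a b = - C b a"
  by (simp add: tors_def)

lemma C_smult [simp]: "C a (z *s b) = z *s C a b" "C (z *s b) a = z *s C b a"
proof -
  have C_scale: "C a (r *\<^sub>R b) = r *\<^sub>R C a b" for r a b
    by (simp add: tors_def hol_def algebra_simps)
  have *: "C a (z *s b) = z *s C a b" for a b
    by (rule complex_linear[where f = "C a"]) (simp_all add: C_scale)
  show "C a (z *s b) = z *s C a b" by (rule *)
  then show "C (z *s b) a = z *s C b a"
    using C_skew[of "z *s b" a] C_skew[of b a] by (simp add: smult_simps)
qed

end

text \<open>Subtract \<open>hol_tors_eq\<close> for the two metrics. With \<open>m\<close> the
  derivative of \<open>\<mu>\<close>, \<open>\<beta>\<close> collects the terms containing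
  \<open>m\<close> or \<open>\<mu>\<close> of a Christoffel term; \<open>wedge_form_of_eq\<close>
  leaves \<open>\<beta>\<close> arbitrary.\<close>

lemma conformal_equation:
  fixes G G' :: "complex^'n \<Rightarrow> complex^'n \<Rightarrow> real"
  assumes jet: "skl_jet G \<Gamma> D" and jet': "skl_jet G' \<Gamma>' D'"
    and \<mu>: "linear \<mu>" "\<And>z x. \<mu> (z *s x) = z * \<mu> x"
    and hol: "\<And>x y. hol \<Gamma>' x y = hol \<Gamma> x y + \<mu> y *s x"
    and D: "\<And>v x y. hol_tors (D' v) x y = hol_tors (D v) x y + m v y *s x - m v x *s y"
  defines "\<beta> \<equiv> \<lambda>v y. m v y - \<i> * m (J v) y - \<mu> (hol \<Gamma> v y)"
  shows "\<beta> v y *s x - \<beta> v x *s y + \<mu> (hol_tors \<Gamma>' x y) *s v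
    - \<mu> x *s hol_tors \<Gamma>' v y - \<mu> y *s hol_tors \<Gamma>' x v = 0"
proof -
  interpret skl_jet G \<Gamma> D by fact
  interpret j': skl_jet G' \<Gamma>' D' by fact
  define C' where "C' = hol_tors \<Gamma>'"
  have C': "C' x y = C x y + \<mu> y *s x - \<mu> x *s y" for x y
    by (simp add: C'_def tors_def hol)
  have smult_sum: "C' (a + b) c = C' a c + C' b c" "C' c (a + b) = C' c a + C' c b"
    "C' (z *s a) c = z *s C' a c" "C' c (z *s a) = z *s C' c a" for a b c z
    unfolding C'_def by simp_all
  note \<mu>_simps = linear_add[OF \<mu>(1)] linear_diff[OF \<mu>(1)] \<mu>(2)
  have 1: "hol_tors (D' v) x y - J (hol_tors (D' (J v)) x y) =
     hol_tors (D v) x y - J (hol_tors (D (J v)) x y) + (m v y - \<i> * m (J v) y) *s x - (m v x - \<i> * m (J v) x) *s y"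
    unfolding D by (simp add: smult_simps)
  \<comment> \<open>Here and in \<open>3\<close>, \<open>4\<close> the new terms keep
    \<open>C'\<close>, so that products of two values of \<open>\<mu>\<close> are never
    expanded.\<close>
  have 2: "hol \<Gamma>' v (C' x y) = hol \<Gamma> v (C x y) + \<mu> y *s hol \<Gamma> v x - \<mu> x *s hol \<Gamma> v y + \<mu> (C' x y) *s v"
    unfolding hol unfolding C' by simp
  have 3: "C' (hol \<Gamma>' v x) y = C (hol \<Gamma> v x) y + \<mu> y *s hol \<Gamma> v x - \<mu> (hol \<Gamma> v x) *s y + \<mu> x *s C' v y"
    unfolding hol smult_sum unfolding C' by simp
  have 4: "C' x (hol \<Gamma>' v y) = C x (hol \<Gamma> v y) + \<mu> (hol \<Gamma> v y) *s x - \<mu> x *s hol \<Gamma> v y + \<mu> y *s C' x v"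
    unfolding hol smult_sum unfolding C' by simp
  have "0 = (hol_tors (D' v) x y - J (hol_tors (D' (J v)) x y)) + hol \<Gamma>' v (C' x y)
     - C' (hol \<Gamma>' v x) y - C' x (hol \<Gamma>' v y)"
    using j'.hol_tors_eq[of v x y] by (simp add: C'_def)
  also have "\<dots> = (hol_tors (D v) x y - J (hol_tors (D (J v)) x y) + hol \<Gamma> v (C x y)
     - C (hol \<Gamma> v x) y - C x (hol \<Gamma> v y)) +
    (\<beta> v y *s x - \<beta> v x *s y + \<mu> (C' x y) *s v - \<mu> x *s C' v y - \<mu> y *s C' x v)"
    unfolding 1 2 3 4 \<beta>_def by (simp add: smult_simps algebra_simps)
  finally show ?thesis
    unfolding hol_tors_eq C'_def by simp
qed

section \<open>Differentiation in a chart\<close>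

locale skl_chart =
  fixes U :: "(complex^'n) set"
    and G :: "complex^'n \<Rightarrow> complex^'n \<Rightarrow> complex^'n \<Rightarrow> real"
    and \<Gamma> :: "complex^'n \<Rightarrow> complex^'n \<Rightarrow> complex^'n \<Rightarrow> complex^'n"
  assumes open_U: "open U"
    and herm: "x \<in> U \<Longrightarrow> hermitian_form (G x)"
    and G_diff: "x \<in> U \<Longrightarrow> (\<lambda>y. G y v w) differentiable (at x)"
    and bil_\<Gamma>: "x \<in> U \<Longrightarrow> bilinear (\<Gamma> x)"
    and \<Gamma>_diff: "x \<in> U \<Longrightarrow> (\<lambda>y. \<Gamma> y v w) differentiable (at x)"
    and metric: "x \<in> U \<Longrightarrow> nabla_metric \<Gamma> G x v a b = 0"
    and parallel_J: "x \<in> U \<Longrightarrow> nabla_J \<Gamma> x v a = 0"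
    and skew: "x \<in> U \<Longrightarrow> totally_skew (\<lambda>a b c. G x (torsion \<Gamma> x a b) c)"
    and kaehler: "x \<in> U \<Longrightarrow> kaehler_symmetries (\<lambda>a b c d. G x (curvature \<Gamma> x a b c) d)"
begin

definition d\<Gamma> where "d\<Gamma> x v a b = frechet_derivative (\<lambda>y. \<Gamma> y a b) (at x) v"

text \<open>Differentiates identities that hold throughout \<open>U\<close>.\<close>

lemma derivative_unique:
  assumes "x \<in> U" "(f has_derivative f') (at x)" "(g has_derivative g') (at x)"
    and "\<And>y. y \<in> U \<Longrightarrow> f y = g y"
  shows "f' v = g' v"
proof -
  have "(g has_derivative f') (at x)"
    by (rule has_derivative_transform_within_open[OF assms(2) open_U assms(1)]) (rule assms(4))
  then show ?thesis using has_derivative_unique assms(3) by metis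
qed

lemma \<Gamma>_J: "x \<in> U \<Longrightarrow> \<Gamma> x v (J a) = J (\<Gamma> x v a)"
  using parallel_J[of x v a] by (simp add: nabla_J_def)

lemma has_derivative_\<Gamma>: "x \<in> U \<Longrightarrow> ((\<lambda>y. \<Gamma> y a b) has_derivative (\<lambda>v. d\<Gamma> x v a b)) (at x)"
  unfolding d\<Gamma>_def using \<Gamma>_diff frechet_derivative_works by blast

lemma bounded_linear_J: "bounded_linear (J :: complex^'n \<Rightarrow> complex^'n)"
  by (intro linear_conv_bounded_linear[THEN iffD1] linearI) simp_all

lemmas has_derivative_J = bounded_linear.has_derivative[OF bounded_linear_J]

lemma has_derivative_tors:
  "x \<in> U \<Longrightarrow> ((\<lambda>y. tors (\<Gamma> y) a b) has_derivative (\<lambda>v. tors (d\<Gamma> x v) a b)) (at x)"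
  unfolding tors_def by (intro derivative_intros has_derivative_\<Gamma>)

lemma has_derivative_hol_tors:
  "x \<in> U \<Longrightarrow> ((\<lambda>y. hol_tors (\<Gamma> y) a b) has_derivative (\<lambda>v. hol_tors (d\<Gamma> x v) a b)) (at x)"
  unfolding tors_def hol_def by (intro derivative_intros has_derivative_\<Gamma> has_derivative_J)

lemma bilinear_d\<Gamma>: assumes x: "x \<in> U" shows "bilinear (d\<Gamma> x v)"
proof -
  note d = has_derivative_\<Gamma>[OF x]
  note e = bilinear_expand[OF bil_\<Gamma>]
  show ?thesis
    unfolding bilinear_def
  proof (intro conjI allI linearI)
    fix a b c :: "complex^'n" and r :: real
    show "d\<Gamma> x v c (a + b) = d\<Gamma> x v c a + d\<Gamma> x v c b"
      by (rule derivative_unique[OF x d has_derivative_add[OF d d]]) (simp add: e)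
    show "d\<Gamma> x v (a + b) c = d\<Gamma> x v a c + d\<Gamma> x v b c"
      by (rule derivative_unique[OF x d has_derivative_add[OF d d]]) (simp add: e)
    show "d\<Gamma> x v c (r *\<^sub>R a) = r *\<^sub>R d\<Gamma> x v c a"
      by (rule derivative_unique[OF x d has_derivative_scaleR_right[OF d]]) (simp add: e)
    show "d\<Gamma> x v (r *\<^sub>R a) c = r *\<^sub>R d\<Gamma> x v a c"
      by (rule derivative_unique[OF x d has_derivative_scaleR_right[OF d]]) (simp add: e)
  qed
qed

end

context skl_chart
begin

text \<open>Product rule in which the metric being parallel replaces the derivative of
  \<open>G\<close> by Christoffel terms.\<close>

lemma has_derivative_metric:
  assumes x: "x \<in> U" and S: "(S has_derivative S') (at x)"
  shows "((\<lambda>y. G y (S y) c) has_derivative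
    (\<lambda>v. G x (\<Gamma> x v (S x)) c + G x (S x) (\<Gamma> x v c) + G x (S' v) c)) (at x)"
proof -
  define dG where "dG v a = G x (\<Gamma> x v a) c + G x a (\<Gamma> x v c)" for v a
  interpret x: hermitian_form "G x" by (rule herm[OF x])
  have d: "((\<lambda>y. G y a c) has_derivative (\<lambda>v. dG v a)) (at x)" for a
  proof -
    have "frechet_derivative (\<lambda>y. G y a c) (at x) = (\<lambda>v. dG v a)"
      using metric[OF x, of _ a c] by (auto simp: nabla_metric_def dG_def algebra_simps)
    then show ?thesis
      using G_diff[OF x, of a c] frechet_derivative_works by metis
  qed
  \<comment> \<open>Differentiability of \<open>G\<close> is given for fixed arguments only, so the
    moving argument \<open>S y\<close> is expanded in a basis.\<close>
  have expand: "f w = (\<Sum>i\<in>Basis. (w \<bullet> i) * f i)" if "linear f" for f :: "complex^'n \<Rightarrow> real" and w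
  proof -
    have "f w = f (\<Sum>i\<in>Basis. (w \<bullet> i) *\<^sub>R i)" by (simp add: euclidean_representation)
    also have "\<dots> = (\<Sum>i\<in>Basis. (w \<bullet> i) * f i)"
      by (simp add: linear_sum[OF that] linear_cmul[OF that])
    finally show ?thesis .
  qed
  have lin: "linear (\<lambda>w. G y w c)" if "y \<in> U" for y
    using hermitian_form.bil[OF herm[OF that]] by (simp add: bilinear_def)
  have lin_dG: "linear (dG v)" for v
    by (rule linearI) (simp_all add: dG_def bilinear_expand[OF bil_\<Gamma>[OF x]] algebra_simps)
  have "((\<lambda>y. \<Sum>i\<in>Basis. (S y \<bullet> i) * G y i c) has_derivative
     (\<lambda>v. \<Sum>i\<in>Basis. (S x \<bullet> i) * dG v i + (S' v \<bullet> i) * G x i c)) (at x)"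
    by (intro has_derivative_sum has_derivative_mult has_derivative_inner_left S d)
  also have "(\<lambda>v. \<Sum>i\<in>Basis. (S x \<bullet> i) * dG v i + (S' v \<bullet> i) * G x i c) =
     (\<lambda>v. G x (\<Gamma> x v (S x)) c + G x (S x) (\<Gamma> x v c) + G x (S' v) c)"
    unfolding sum.distrib expand[OF lin_dG, symmetric] expand[OF lin[OF x], symmetric] by (simp add: dG_def)
  finally show ?thesis
    by (rule has_derivative_transform_within_open[OF _ open_U x]) (simp add: expand[OF lin, symmetric])
qed

lemma jet: assumes x: "x \<in> U" shows "skl_jet (G x) (\<Gamma> x) (d\<Gamma> x)"
proof -
  interpret x: hermitian_form "G x" by (rule herm[OF x])
  note e = bilinear_expand[OF bil_\<Gamma>[OF x]]
  have tors: "torsion \<Gamma> y a b = tors (\<Gamma> y) a b" for y a b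
    by (simp add: torsion_def tors_def)
  have sk: "G y (tors (\<Gamma> y) a b) c = - G y (tors (\<Gamma> y) b a) c"
      "G y (tors (\<Gamma> y) a b) c = - G y (tors (\<Gamma> y) a c) b" if "y \<in> U" for y a b c
    using skew[OF that] unfolding totally_skew_def tors by blast+
  define t where "t v a b c = G x (\<Gamma> x v (tors (\<Gamma> x) a b)) c + G x (tors (\<Gamma> x) a b) (\<Gamma> x v c)
      + G x (tors (d\<Gamma> x v) a b) c" for v a b c
  have t: "((\<lambda>y. G y (tors (\<Gamma> y) a b) c) has_derivative (\<lambda>v. t v a b c)) (at x)" for a b c
    unfolding t_def by (rule has_derivative_metric[OF x has_derivative_tors[OF x]])
  have t_skew: "t v a b c = - t v b a c" "t v a b c = - t v a c b" for v a b c
    by (rule derivative_unique[OF x t[of a b c] has_derivative_minus[OF t[of b a c]]], erule sk(1))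
      (rule derivative_unique[OF x t[of a b c] has_derivative_minus[OF t[of a c b]]], erule sk(2))
  \<comment> \<open>Lowering an index commutes with the covariant derivative. Skewness thus passes
    from the torsion and from \<open>t\<close>, its lowered derivative, to the covariant
    derivative.\<close>
  have cov: "G x (cov (\<Gamma> x) (\<lambda>v. tors (d\<Gamma> x v)) (tors (\<Gamma> x)) v a b) c = t v a b c
    - G x (tors (\<Gamma> x) a b) (\<Gamma> x v c) - G x (tors (\<Gamma> x) (\<Gamma> x v a) b) c - G x (tors (\<Gamma> x) a (\<Gamma> x v b)) c"
    for v a b c
    by (simp add: cov_def t_def)
  show ?thesis
  proof
    show "bilinear (\<Gamma> x)" by (rule bil_\<Gamma>[OF x])
    show "bilinear (d\<Gamma> x v)" for v by (rule bilinear_d\<Gamma>[OF x])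
    show "\<Gamma> x v (J a) = J (\<Gamma> x v a)" for v a by (rule \<Gamma>_J[OF x])
    show "d\<Gamma> x v a (J b) = J (d\<Gamma> x v a b)" for v a b
      by (rule derivative_unique[OF x has_derivative_\<Gamma>[OF x] has_derivative_J[OF has_derivative_\<Gamma>[OF x]]])
        (rule \<Gamma>_J)
    show "totally_skew (\<lambda>a b c. G x (tors (\<Gamma> x) a b) c)"
      using skew[OF x] by (simp add: tors)
    show "totally_skew (\<lambda>a b c. G x (cov (\<Gamma> x) (\<lambda>v. tors (d\<Gamma> x v)) (tors (\<Gamma> x)) v a b) c)" for v
      unfolding totally_skew_def cov using t_skew sk[OF x] by (smt (verit))
    have "(\<lambda>v w a. d\<Gamma> x v w a - d\<Gamma> x w v a + \<Gamma> x v (\<Gamma> x w a) - \<Gamma> x w (\<Gamma> x v a)) = curvature \<Gamma> x"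
      by (simp add: fun_eq_iff curvature_def d\<Gamma>_def)
    then show "let R = \<lambda>v w a. d\<Gamma> x v w a - d\<Gamma> x w v a + \<Gamma> x v (\<Gamma> x w a) - \<Gamma> x w (\<Gamma> x v a)
       in G x (R a b c) d + G x (R b c a) d + G x (R c a b) d = 0" for a b c d
      using kaehler[OF x] unfolding kaehler_symmetries_def by (simp add: Let_def)
  qed
qed

end

lemma bounded_linear_smult_left: "bounded_linear (\<lambda>z. z *s (b :: complex^'n))"
  by (intro linear_conv_bounded_linear[THEN iffD1] linearI) (simp_all add: vec_eq_iff algebra_simps)

context skl_chart
begin

text \<open>Having \<open>h\<close> on an open set allows \<open>C\<close> to be differentiated,
  which gives its covariant derivative the wedge shape that \<open>wedge_form_zero\<close>
  demands.\<close>

lemma wedge_form_zero_on: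
  assumes n: "CARD('n) \<ge> 3" and x: "x \<in> U"
    and h: "\<And>y. y \<in> U \<Longrightarrow> linear (h y)" "\<And>y z a. y \<in> U \<Longrightarrow> h y (z *s a) = z * h y a"
    and C: "\<And>y a b. y \<in> U \<Longrightarrow> hol_tors (\<Gamma> y) a b = h y a *s b - h y b *s a"
  shows "h x a = 0"
proof -
  interpret skl_jet "G x" "\<Gamma> x" "d\<Gamma> x" by (rule jet[OF x])
  define h' where "h' v a = (\<Sum>i\<in>UNIV. hol_tors (d\<Gamma> x v) a (axis i 1) $ i) / of_nat (CARD('n) - 1)" for v a
  \<comment> \<open>The trace formula shows that \<open>h\<close> is differentiable.\<close>
  have trace: "h y a = (\<Sum>i\<in>UNIV. hol_tors (\<Gamma> y) a (axis i 1) $ i) / of_nat (CARD('n) - 1)" if "y \<in> U" for y a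
  proof -
    have "h y a = h y (\<Sum>i\<in>UNIV. (a $ i) *s axis i 1)" by (simp add: basis_expansion)
    also have "\<dots> = (\<Sum>i\<in>UNIV. (a $ i) * h y (axis i 1))"
      by (simp add: linear_sum[OF h(1)[OF that]] h(2)[OF that])
    \<comment> \<open>The map taking \<open>b\<close> to \<open>h a *s b\<close> has trace n times
      \<open>h a\<close>, the one taking \<open>b\<close> to \<open>h b *s a\<close> has trace
      \<open>h a\<close>.\<close>
    finally have "(\<Sum>i\<in>UNIV. hol_tors (\<Gamma> y) a (axis i 1) $ i) = of_nat (CARD('n)) * h y a - h y a"
      by (simp add: C[OF that] sum_subtractf axis_def mult.commute)
    also have "\<dots> = of_nat (CARD('n) - 1) * h y a"
      using n by (simp add: of_nat_diff algebra_simps)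
    finally show ?thesis using n by simp
  qed
  have "((\<lambda>y. (\<Sum>i\<in>UNIV. hol_tors (\<Gamma> y) a (axis i 1) $ i) / of_nat (CARD('n) - 1)) has_derivative (\<lambda>v. h' v a)) (at x)" for a
    unfolding h'_def divide_inverse
    by (intro has_derivative_mult_left has_derivative_sum bounded_linear.has_derivative[OF bounded_linear_vec_nth]
        has_derivative_hol_tors x)
  then have h': "((\<lambda>y. h y a) has_derivative (\<lambda>v. h' v a)) (at x)" for a
    by (rule has_derivative_transform_within_open[OF _ open_U x]) (simp add: trace)
  have "hol_tors (d\<Gamma> x v) a b = h' v a *s b - h' v b *s a" for v a b
    by (rule derivative_unique[OF x has_derivative_hol_tors[OF x]
          has_derivative_diff[OF bounded_linear.has_derivative[OF bounded_linear_smult_left h'] bounded_linear.has_derivative[OF bounded_linear_smult_left h']]])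
      (rule C)
  moreover have "\<Gamma> x v (z *s a) = z *s \<Gamma> x v a" for v z a
    by (rule complex_linear) simp_all
  \<comment> \<open>Complex linearity of \<open>\<Gamma> x v\<close> cancels the terms where it acts
    on a vector outside \<open>h\<close>.\<close>
  ultimately have nC: "nC v a b = (h' v a - h x (\<Gamma> x v a)) *s b - (h' v b - h x (\<Gamma> x v b)) *s a" for v a b
    by (simp add: cov_def C[OF x] smult_simps)
  show ?thesis
    by (rule wedge_form_zero[OF n h(1)[OF x] h(2)[OF x] C[OF x] nC])
qed

lemma restrict: "open W \<Longrightarrow> W \<subseteq> U \<Longrightarrow> skl_chart W G \<Gamma>"
  using skl_chart_axioms unfolding skl_chart_def by blast

end

section \<open>Vanishing of the differential of the conformal factor\<close>

text \<open>Otherwise, near \<open>x\<close>, both torsions have wedge shape, with forms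
  \<open>h\<close> and \<open>h + \<mu>\<close>; both forms vanish at \<open>x\<close>, hence so
  does \<open>\<mu>\<close>.\<close>

lemma conformal_derivative_zero:
  fixes U :: "(complex^'n) set"
  assumes c: "skl_chart U G \<Gamma>" and c': "skl_chart U G' \<Gamma>'"
    and n: "CARD('n) \<ge> 3"
    and conf: "\<And>y v w. y \<in> U \<Longrightarrow> G' y v w = exp (2 * u y) * G y v w"
    and u: "\<And>y. y \<in> U \<Longrightarrow> (u has_derivative l y) (at y)"
    and l: "\<And>y v. y \<in> U \<Longrightarrow> (\<lambda>y. l y v) differentiable (at y)"
    and x: "x \<in> U"
  shows "l x p = 0"
proof (rule ccontr)
  assume p: "l x p \<noteq> 0"
  interpret skl_chart U G \<Gamma> by fact
  interpret c': skl_chart U G' \<Gamma>' by fact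
  \<comment> \<open>Four times the (1,0) part of \<open>du\<close>, the factor found in
    \<open>conformal_change\<close>.\<close>
  define \<mu> where "\<mu> y a = 2 * Complex (l y a) (- l y (J a))" for y a
  have \<mu>_lin: "linear (\<mu> y)" "\<mu> y (z *s a) = z * \<mu> y a" if y: "y \<in> U" for y z a
  proof -
    have l_lin: "linear (l y)" by (rule has_derivative_linear[OF u[OF y]])
    note l_simps = linear_add[OF l_lin] linear_cmul[OF l_lin] linear_neg[OF l_lin]
    show *: "linear (\<mu> y)"
      by (rule linearI) (simp_all add: \<mu>_def l_simps complex_eq_iff algebra_simps)
    have "\<mu> y (z *s a) = Re z *\<^sub>R \<mu> y a + Im z *\<^sub>R \<mu> y (J a)"
      unfolding complex_smult[of z] by (simp add: linear_add[OF *] linear_cmul[OF *])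
    moreover have "\<mu> y (J a) = \<i> * \<mu> y a"
      by (simp add: \<mu>_def l_simps complex_eq_iff)
    ultimately show "\<mu> y (z *s a) = z * \<mu> y a"
      by (simp add: complex_eq_iff)
  qed
  have hol: "hol (\<Gamma>' y) a b = hol (\<Gamma> y) a b + \<mu> y b *s a" if y: "y \<in> U" for y a b
  proof -
    interpret y: hermitian_form "G y" by (rule herm[OF y])
    interpret y': hermitian_form "G' y" by (rule c'.herm[OF y])
    define B where "B v w = \<Gamma>' y v w - \<Gamma> y v w" for v w
    have "hol B a b = (2 * Complex (l y b) (- l y (J b))) *s a"
    proof (rule y.conformal_change)
      show "B v (J w) = J (B v w)" for v w
        by (simp add: B_def \<Gamma>_J[OF y] c'.\<Gamma>_J[OF y])
      fix v w z
      have e: "((\<lambda>y. exp (2 * u y)) has_derivative (\<lambda>v. exp (2 * u y) * (2 * l y v))) (at y)"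
        using u[OF y] by (auto intro!: derivative_eq_intros)
      have g: "((\<lambda>y. G y w z) has_derivative (\<lambda>v. G y (\<Gamma> y v w) z + G y w (\<Gamma> y v z))) (at y)"
        using has_derivative_metric[OF y has_derivative_const, of w z] by simp
      have g': "((\<lambda>y. G' y w z) has_derivative (\<lambda>v. G' y (\<Gamma>' y v w) z + G' y w (\<Gamma>' y v z))) (at y)"
        using c'.has_derivative_metric[OF y has_derivative_const, of w z] by simp
      have "G' y (\<Gamma>' y v w) z + G' y w (\<Gamma>' y v z) =
        exp (2 * u y) * (G y (\<Gamma> y v w) z + G y w (\<Gamma> y v z)) + exp (2 * u y) * (2 * l y v) * G y w z"
        by (rule derivative_unique[OF y g' has_derivative_mult[OF e g]]) (rule conf)
      then have "exp (2 * u y) * (G y (\<Gamma>' y v w) z + G y w (\<Gamma>' y v z)) =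
        exp (2 * u y) * (G y (\<Gamma> y v w) z + G y w (\<Gamma> y v z) + 2 * l y v * G y w z)"
        unfolding conf[OF y] by (simp add: algebra_simps)
      then have "G y (\<Gamma>' y v w) z + G y w (\<Gamma>' y v z) =
        G y (\<Gamma> y v w) z + G y w (\<Gamma> y v z) + 2 * l y v * G y w z"
        by simp
      then show "G y (B v w) z + G y w (B v z) = 2 * l y v * G y w z"
        by (simp add: B_def)
    next
      have "tors B a b = tors (\<Gamma>' y) a b - tors (\<Gamma> y) a b" for a b
        by (simp add: tors_def B_def)
      then have B: "G y (tors B a b) c = G y (tors (\<Gamma>' y) a b) c - G y (tors (\<Gamma> y) a b) c" for a b c
        by simp
      \<comment> \<open>Dividing by the conformal factor turns skewness with respect to
        \<open>G'\<close> into skewness with respect to \<open>G\<close>.\<close>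
      have cancel: "s = - t" if "exp (2 * u y) * s = - (exp (2 * u y) * t)" for s t
        using that by (metis exp_not_eq_zero mult_left_cancel mult_minus_right)
      have "G y (tors (\<Gamma>' y) a b) c = - G y (tors (\<Gamma>' y) b a) c"
        "G y (tors (\<Gamma>' y) a b) c = - G y (tors (\<Gamma>' y) a c) b" for a b c
        using skl_jet.T_skew[OF c'.jet[OF y], of a b c] unfolding conf[OF y] by (auto dest: cancel)
      then show "totally_skew (\<lambda>a b c. G y (tors B a b) c)"
        unfolding totally_skew_def B using skl_jet.T_skew[OF jet[OF y]]
        by (metis minus_diff_minus)
    qed
    moreover have "hol B a b = hol (\<Gamma>' y) a b - hol (\<Gamma> y) a b"
      by (simp add: hol_def B_def)
    ultimately show ?thesis by (simp add: \<mu>_def algebra_simps)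
  qed
  have tors: "hol_tors (\<Gamma>' y) a b = hol_tors (\<Gamma> y) a b + (\<mu> y b *s a - \<mu> y a *s b)" if "y \<in> U" for y a b
    using hol[OF that] by (simp add: tors_def)
  have wedge: "\<exists>h. linear h \<and> (\<forall>z a. h (z *s a) = z * h a) \<and> (\<forall>a b. hol_tors (\<Gamma>' y) a b = h a *s b - h b *s a)"
    if y: "y \<in> U" and ly: "l y p \<noteq> 0" for y
  proof -
    interpret y: skl_jet "G y" "\<Gamma> y" "d\<Gamma> y" by (rule jet[OF y])
    interpret y': skl_jet "G' y" "\<Gamma>' y" "c'.d\<Gamma> y" by (rule c'.jet[OF y])
    define m where "m v a = 2 * Complex (frechet_derivative (\<lambda>y. l y a) (at y) v)
       (- frechet_derivative (\<lambda>y. l y (J a)) (at y) v)" for v a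
    have m: "((\<lambda>y. \<mu> y a *s b) has_derivative (\<lambda>v. m v a *s b)) (at y)" for a b
    proof -
      have d: "((\<lambda>y. l y a) has_derivative frechet_derivative (\<lambda>y. l y a) (at y)) (at y)" for a
        using l[OF y] frechet_derivative_works by blast
      have "((\<lambda>y. \<mu> y a) has_derivative (\<lambda>v. m v a)) (at y)"
        unfolding \<mu>_def m_def Complex_eq
        by (intro has_derivative_mult_right has_derivative_add has_derivative_of_real has_derivative_minus d)
      then show ?thesis by (rule bounded_linear.has_derivative[OF bounded_linear_smult_left])
    qed
    have D: "hol_tors (c'.d\<Gamma> y v) a b = hol_tors (d\<Gamma> y v) a b + (m v b *s a - m v a *s b)" for v a b
      by (rule derivative_unique[OF y c'.has_derivative_hol_tors[OF y]
            has_derivative_add[OF has_derivative_hol_tors[OF y] has_derivative_diff[OF m m]]]) (rule tors)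
    note eq = conformal_equation[OF jet[OF y] c'.jet[OF y] \<mu>_lin[OF y] hol[OF y], where m = m]
    have "\<mu> y p \<noteq> 0" using ly by (simp add: \<mu>_def complex_eq_iff)
    then obtain h where "linear h" "\<And>z x. h (z *s x) = z * h x"
      "\<And>a b. hol_tors (\<Gamma>' y) a b = h a *s b - h b *s a"
      using wedge_form_of_eq[OF n \<mu>_lin[OF y] _ y'.C_lin(2) y'.C_smult(1) y'.C_skew eq] D
      by (metis add_diff_eq)
    then show ?thesis by blast
  qed
  define W where "W = {y \<in> U. l y p \<noteq> 0}"
  have "continuous_on U (\<lambda>y. l y p)"
    by (intro continuous_at_imp_continuous_on ballI differentiable_imp_continuous_within l)
  then have "open W"
    unfolding W_def using open_U continuous_open_preimage[of U "\<lambda>y. l y p" "- {0}"]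
    by (simp add: vimage_def Int_def open_Compl)
  have W: "W \<subseteq> U" "x \<in> W" using x p by (auto simp: W_def)
  \<comment> \<open>Chosen pointwise on \<open>W\<close>; differentiability of \<open>h\<close>
    comes from the trace formula in \<open>wedge_form_zero_on\<close>.\<close>
  obtain h where h: "\<And>y. y \<in> W \<Longrightarrow> linear (h y)" "\<And>y z a. y \<in> W \<Longrightarrow> h y (z *s a) = z * h y a"
    "\<And>y a b. y \<in> W \<Longrightarrow> hol_tors (\<Gamma>' y) a b = h y a *s b - h y b *s a"
    using wedge unfolding W_def by (metis (mono_tags, lifting) mem_Collect_eq)
  have "h x a = 0" for a
    by (rule skl_chart.wedge_form_zero_on[OF c'.restrict[OF \<open>open W\<close> W(1)] n W(2) h])
  moreover have "h x a + \<mu> x a = 0" for a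
  proof (rule skl_chart.wedge_form_zero_on[OF restrict[OF \<open>open W\<close> W(1)] n W(2)])
    fix y assume y: "y \<in> W"
    then have yU: "y \<in> U" using W by blast
    show "linear (\<lambda>a. h y a + \<mu> y a)" using h(1)[OF y] \<mu>_lin[OF yU] by (intro linear_compose_add)
    show "h y (z *s a) + \<mu> y (z *s a) = z * (h y a + \<mu> y a)" for z a
      by (simp add: h(2)[OF y] \<mu>_lin(2)[OF yU] algebra_simps)
    show "hol_tors (\<Gamma> y) a b = (h y a + \<mu> y a) *s b - (h y b + \<mu> y b) *s a" for a b
      using h(3)[OF y, of a b] tors[OF yU, of a b] by (simp add: smult_simps algebra_simps)
  qed
  ultimately have "\<mu> x p = 0" by simp
  then show False using p by (simp add: \<mu>_def complex_eq_iff)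
qed

section \<open>Passage between the manifold and its charts\<close>

lemma smooth_map_on_has_derivative:
  assumes "smooth_map_on S f" "x \<in> S"
  shows "(f has_derivative frechet_derivative f (at x)) (at x)"
    "(\<lambda>y. frechet_derivative f (at y) v) differentiable (at x)"
proof -
  have "Ck_on 2 S f" using assms(1) by (simp add: smooth_map_on_def)
  then show "(f has_derivative frechet_derivative f (at x)) (at x)"
    "(\<lambda>y. frechet_derivative f (at y) v) differentiable (at x)"
    using assms(2) frechet_derivative_works by (auto simp: numeral_2_eq_2)
qed

lemma hermitian_form_scale:
  assumes "hermitian_form G" and "c > 0"
  shows "hermitian_form (\<lambda>v w. c * G v w)"
proof -
  interpret hermitian_form G by fact
  show ?thesis
    by unfold_locales
      (auto simp: bilinear_def linear_iff algebra_simps sym J_inv assms(2) pos)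
qed

text \<open>That \<open>g'\<close> is Hermitian and differentiable is derived from \<open>g\<close>
  and \<open>u\<close>, since \<open>strominger_kaehler_like\<close> does not include it.\<close>

lemma conformal_skl_chart:
  assumes mfd: "complex_manifold X A" and g: "hermitian_metric A g"
    and u: "smooth_function A u"
    and g': "\<And>\<phi> x v w. \<phi> \<in> A \<Longrightarrow> x \<in> chart_image \<phi> \<Longrightarrow>
      g' \<phi> x v w = exp (2 * u (chart_inv \<phi> x)) * g \<phi> x v w"
    and skl: "strominger_kaehler_like A g'" and \<phi>: "\<phi> \<in> A"
  obtains \<Gamma> where "skl_chart (chart_image \<phi>) (g' \<phi>) \<Gamma>"
proof -
  obtain \<Gamma> where \<Gamma>: "strominger_connection A g' \<Gamma>"
    and K: "\<And>x. x \<in> chart_image \<phi> \<Longrightarrow> kaehler_symmetries (\<lambda>a b c d. g' \<phi> x (curvature (\<Gamma> \<phi>) x a b c) d)"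
    using skl \<phi> unfolding strominger_kaehler_like_def by blast
  have op: "open (chart_image \<phi>)"
    using mfd \<phi> unfolding complex_manifold_def is_chart_def by blast
  have "skl_chart (chart_image \<phi>) (g' \<phi>) (\<Gamma> \<phi>)"
  proof (rule skl_chart.intro)
    fix x v w a assume x: "x \<in> chart_image \<phi>"
    have "bilinear (g \<phi> x)" "\<And>v w. g \<phi> x v w = g \<phi> x w v" "\<And>v. v \<noteq> 0 \<Longrightarrow> g \<phi> x v v > 0"
      "\<And>v w. g \<phi> x (J v) (J w) = g \<phi> x v w"
      using g \<phi> x unfolding hermitian_metric_def by blast+
    then have "hermitian_form (g \<phi> x)" by unfold_locales
    then have "hermitian_form (\<lambda>v w. exp (2 * u (chart_inv \<phi> x)) * g \<phi> x v w)"
      by (rule hermitian_form_scale) simp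
    moreover have "g' \<phi> x = (\<lambda>v w. exp (2 * u (chart_inv \<phi> x)) * g \<phi> x v w)"
      by (intro ext g'[OF \<phi> x])
    ultimately show "hermitian_form (g' \<phi> x)" by (simp only:)
    have s: "smooth_map_on (chart_image \<phi>) (u \<circ> chart_inv \<phi>)"
      using u \<phi> by (simp add: smooth_function_def)
    have s': "smooth_map_on (chart_image \<phi>) (\<lambda>y. g \<phi> y v w)"
      using g \<phi> by (simp add: hermitian_metric_def)
    have s'': "smooth_map_on (chart_image \<phi>) (\<lambda>y. \<Gamma> \<phi> y v w)"
      using \<Gamma> \<phi> by (simp add: strominger_connection_def connection_def)
    note d = smooth_map_on_has_derivative(1)[OF _ x]
    show "(\<lambda>y. g' \<phi> y v w) differentiable (at x)"
      by (rule differentiableI, rule has_derivative_transform_within_open[OF has_derivative_mult[OF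
              has_derivative_exp[OF has_derivative_mult_right[where x = 2, OF d[OF s]]] d[OF s']] op x])
        (simp add: g'[OF \<phi>])
    show "(\<lambda>y. \<Gamma> \<phi> y v w) differentiable (at x)" by (rule differentiableI[OF d[OF s'']])
    show "bilinear (\<Gamma> \<phi> x)" "nabla_metric (\<Gamma> \<phi>) (g' \<phi>) x v a w = 0" "nabla_J (\<Gamma> \<phi>) x v a = 0"
      "totally_skew (\<lambda>a b c. g' \<phi> x (torsion (\<Gamma> \<phi>) x a b) c)"
      using \<Gamma> \<phi> x unfolding strominger_connection_def connection_def by blast+
    show "kaehler_symmetries (\<lambda>a b c d. g' \<phi> x (curvature (\<Gamma> \<phi>) x a b c) d)" by (rule K[OF x])
  qed (rule op)
  then show ?thesis by (rule that)
qed

lemma connected_space_locally_constant: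
  assumes "connected_space X"
    and loc: "\<And>p. p \<in> topspace X \<Longrightarrow> \<exists>N. openin X N \<and> p \<in> N \<and> (\<forall>q\<in>N. u q = u p)"
    and "p \<in> topspace X" "q \<in> topspace X"
  shows "u q = u p"
proof -
  define S where "S = {r \<in> topspace X. u r = u p}"
  \<comment> \<open>A general predicate covers both the level set and its complement.\<close>
  have op: "openin X {r \<in> topspace X. P (u r)}" for P
  proof (subst openin_subopen, intro ballI)
    fix r assume "r \<in> {r \<in> topspace X. P (u r)}"
    then have r: "r \<in> topspace X" "P (u r)" by simp_all
    obtain N where N: "openin X N" "r \<in> N" "\<And>q. q \<in> N \<Longrightarrow> u q = u r" using loc[OF r(1)] by metis
    have "N \<subseteq> {r \<in> topspace X. P (u r)}"
    proof
      fix q assume q: "q \<in> N"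
      show "q \<in> {r \<in> topspace X. P (u r)}"
        using openin_subset[OF N(1)] q N(3)[OF q] r(2) by auto
    qed
    with N(1,2) show "\<exists>T. openin X T \<and> r \<in> T \<and> T \<subseteq> {r \<in> topspace X. P (u r)}"
      by blast
  qed
  have "topspace X - S = {r \<in> topspace X. u r \<noteq> u p}" by (auto simp: S_def)
  then have "openin X S" "openin X (topspace X - S)"
    using op[of "\<lambda>t. t = u p"] op[of "\<lambda>t. t \<noteq> u p"] by (simp_all add: S_def)
  moreover have "S \<subseteq> topspace X" by (auto simp: S_def)
  ultimately have "openin X S \<and> closedin X S" by (simp add: closedin_def)
  then have "S = {} \<or> S = topspace X"
    using assms(1) unfolding connected_space_clopen_in by blast
  then show ?thesis using assms(3,4) by (auto simp: S_def)
qed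

lemma chart_inv_inverse:
  assumes "is_chart X \<phi>" and p: "p \<in> fst \<phi>"
  shows "chart_inv \<phi> (snd \<phi> p) = p"
proof -
  have "fst \<phi> \<subseteq> topspace X" using assms(1) openin_subset unfolding is_chart_def by blast
  then have "inj_on (snd \<phi>) (fst \<phi>)"
    using assms(1) homeomorphic_imp_injective_map unfolding is_chart_def
    by (metis inf.absorb_iff2 topspace_subtopology)
  then show ?thesis using p by (simp add: chart_inv_def)
qed

text \<open>On a ball in the chart image, which is convex, the local expression is constant; the
  preimage of the ball is the neighbourhood.\<close>

lemma locally_constant_of_derivative_zero:
  fixes \<phi> :: "('a, 'n::finite) chart"
  assumes \<phi>: "is_chart X \<phi>" and p: "p \<in> fst \<phi>"
    and d: "\<And>x. x \<in> chart_image \<phi> \<Longrightarrow> ((u \<circ> chart_inv \<phi>) has_derivative (\<lambda>v. 0)) (at x)"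
  shows "\<exists>N. openin X N \<and> p \<in> N \<and> (\<forall>q\<in>N. u q = (u p :: real))"
proof -
  have "snd \<phi> p \<in> chart_image \<phi>" "open (chart_image \<phi>)" using p \<phi> by (auto simp: is_chart_def)
  then obtain e where e: "e > 0" "ball (snd \<phi> p) e \<subseteq> chart_image \<phi>" using open_contains_ball by blast
  have "\<exists>c. \<forall>x\<in>ball (snd \<phi> p) e. (u \<circ> chart_inv \<phi>) x = c"
  proof (rule has_derivative_zero_constant)
    fix x assume "x \<in> ball (snd \<phi> p) e"
    then show "((u \<circ> chart_inv \<phi>) has_derivative (\<lambda>h. 0)) (at x within ball (snd \<phi> p) e)"
      using e(2) by (blast intro: has_derivative_at_withinI[OF d])
  qed simp
  then obtain c where c: "\<forall>x\<in>ball (snd \<phi> p) e. (u \<circ> chart_inv \<phi>) x = c" by blast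
  define N where "N = {q \<in> fst \<phi>. snd \<phi> q \<in> ball (snd \<phi> p) e}"
  have sub: "fst \<phi> \<subseteq> topspace X" "openin X (fst \<phi>)" using \<phi> openin_subset unfolding is_chart_def by blast+
  have "continuous_map (subtopology X (fst \<phi>)) (top_of_set (chart_image \<phi>)) (snd \<phi>)"
    using \<phi> homeomorphic_imp_continuous_map unfolding is_chart_def by blast
  moreover have "openin (top_of_set (chart_image \<phi>)) (ball (snd \<phi> p) e)"
    using e(2) by (simp add: open_subset)
  ultimately have "openin (subtopology X (fst \<phi>)) {q \<in> topspace (subtopology X (fst \<phi>)). snd \<phi> q \<in> ball (snd \<phi> p) e}"
    by (rule openin_continuous_map_preimage)
  moreover have "topspace (subtopology X (fst \<phi>)) = fst \<phi>" using sub(1) by auto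
  ultimately have "openin (subtopology X (fst \<phi>)) N"
    by (simp only: N_def)
  then have "openin X N"
    using sub(2) by (simp add: openin_open_subtopology)
  moreover have "p \<in> N" using p e(1) by (simp add: N_def)
  moreover have const: "u q = c" if "q \<in> N" for q
    using that bspec[OF c, of "snd \<phi> q"] chart_inv_inverse[OF \<phi>, of q] by (simp add: N_def)
  ultimately show ?thesis
    using const[OF \<open>p \<in> N\<close>] by (intro exI[of _ N] conjI ballI) (simp_all only:)
qed

theorem theorem3:
  fixes X :: "'a topology"
    and A :: "('a, 'n::finite) chart set"
    and g g1 g2 :: "('a, 'n) metric"
  assumes "complex_manifold X A"
    and "connected_space X"
    and "CARD('n) \<ge> 3"
    and "hermitian_metric A g"
    and "in_conformal_class A g g1" and "strominger_kaehler_like A g1"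
    and "in_conformal_class A g g2" and "strominger_kaehler_like A g2"
  shows "\<exists>c>0. \<forall>\<phi>\<in>A. \<forall>x\<in>chart_image \<phi>. \<forall>v w. g2 \<phi> x v w = c * g1 \<phi> x v w"
proof -
  obtain u1 where u1: "smooth_function A u1" and g1: "\<And>\<phi> x v w. \<phi> \<in> A \<Longrightarrow> x \<in> chart_image \<phi> \<Longrightarrow>
      g1 \<phi> x v w = exp (2 * u1 (chart_inv \<phi> x)) * g \<phi> x v w"
    using assms(5) unfolding in_conformal_class_def by blast
  obtain u2 where u2: "smooth_function A u2" and g2: "\<And>\<phi> x v w. \<phi> \<in> A \<Longrightarrow> x \<in> chart_image \<phi> \<Longrightarrow>
      g2 \<phi> x v w = exp (2 * u2 (chart_inv \<phi> x)) * g \<phi> x v w"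
    using assms(7) unfolding in_conformal_class_def by blast
  \<comment> \<open>Eliminates \<open>g\<close>: the two SKL metrics are compared directly.\<close>
  define u where "u p = u2 p - u1 p" for p
  have conf: "g2 \<phi> x v w = exp (2 * u (chart_inv \<phi> x)) * g1 \<phi> x v w" if "\<phi> \<in> A" "x \<in> chart_image \<phi>" for \<phi> x v w
    by (simp add: g1[OF that] g2[OF that] u_def right_diff_distrib flip: exp_add mult.assoc)
  have chart: "is_chart X \<phi>" if "\<phi> \<in> A" for \<phi>
    using assms(1) that unfolding complex_manifold_def by blast
  have zero: "((u \<circ> chart_inv \<phi>) has_derivative (\<lambda>v. 0)) (at x)" if \<phi>: "\<phi> \<in> A" and x: "x \<in> chart_image \<phi>" for \<phi> x
  proof -
    let ?U = "chart_image \<phi>"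
    define l where "l y v = frechet_derivative (u2 \<circ> chart_inv \<phi>) (at y) v
        - frechet_derivative (u1 \<circ> chart_inv \<phi>) (at y) v" for y v
    have s: "smooth_map_on ?U (u1 \<circ> chart_inv \<phi>)" "smooth_map_on ?U (u2 \<circ> chart_inv \<phi>)"
      using u1 u2 \<phi> by (auto simp: smooth_function_def)
    have l: "((u \<circ> chart_inv \<phi>) has_derivative l y) (at y)" "(\<lambda>y. l y v) differentiable (at y)" if "y \<in> ?U" for y v
    proof -
      have "((\<lambda>y. (u2 \<circ> chart_inv \<phi>) y - (u1 \<circ> chart_inv \<phi>) y) has_derivative l y) (at y)"
        unfolding l_def using s that by (intro has_derivative_diff smooth_map_on_has_derivative(1))
      then show "((u \<circ> chart_inv \<phi>) has_derivative l y) (at y)" by (simp add: u_def comp_def)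
      show "(\<lambda>y. l y v) differentiable (at y)"
        unfolding l_def using s that by (intro differentiable_diff smooth_map_on_has_derivative(2))
    qed
    obtain \<Gamma>1 where \<Gamma>1: "skl_chart ?U (g1 \<phi>) \<Gamma>1"
      using conformal_skl_chart[OF assms(1,4) u1 g1 assms(6) \<phi>] by blast
    obtain \<Gamma>2 where \<Gamma>2: "skl_chart ?U (g2 \<phi>) \<Gamma>2"
      using conformal_skl_chart[OF assms(1,4) u2 g2 assms(8) \<phi>] by blast
    have "l x v = 0" for v
      by (rule conformal_derivative_zero[OF \<Gamma>1 \<Gamma>2 assms(3) _ l x]) (simp_all add: conf[OF \<phi>])
    then have "l x = (\<lambda>v. 0)" by blast
    then show ?thesis using l(1)[OF x] by simp
  qed
  have const: "u q = u p" if "p \<in> topspace X" "q \<in> topspace X" for p q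
  proof (rule connected_space_locally_constant[OF assms(2) _ that])
    fix p assume "p \<in> topspace X"
    then obtain \<phi> where "\<phi> \<in> A" "p \<in> fst \<phi>" using assms(1) unfolding complex_manifold_def by blast
    then show "\<exists>N. openin X N \<and> p \<in> N \<and> (\<forall>q\<in>N. u q = u p)"
      by (intro locally_constant_of_derivative_zero[OF chart _ zero])
  qed
  \<comment> \<open>The premise covers empty \<open>X\<close>, where any \<open>a\<close>
    serves.\<close>
  obtain a where a: "u p = a" if "p \<in> topspace X" for p
    using const by metis
  have "g2 \<phi> x v w = exp (2 * a) * g1 \<phi> x v w" if "\<phi> \<in> A" "x \<in> chart_image \<phi>" for \<phi> x v w
  proof -
    have "chart_inv \<phi> x \<in> fst \<phi>" using that(2) by (metis chart_inv_def inv_into_into)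
    then have "chart_inv \<phi> x \<in> topspace X"
      using chart[OF that(1)] openin_subset unfolding is_chart_def by blast
    then show ?thesis using conf[OF that] a by simp
  qed
  then show ?thesis by (intro exI[of _ "exp (2 * a)"]) simp
qed

end
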